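(* For every integer $k\ge 1$ and all $\mathcal{A},\mathcal{B}\in PL^{(k)}$ there exists $\mathcal{C}\in PL^{(k)}$ such that for every $2$-colouring of the set $\binom{\mathcal{C}}{\mathcal{A}}$ there is a copy $\tilde{\mathcal{B}}\in\binom{\mathcal{C}}{\mathcal{B}}$ of $\mathcal{B}$ in $\mathcal{C}$ such that the set $\binom{\tilde{\mathcal{B}}}{\mathcal{A}}$ is monochromatic (all its elements receive the same colour).
   Context: All sets are finite. A poset is a pair $(X,P^X)$ where $P^X$ is a strict (irreflexive) partial order on the set $X$; linear orders are also strict. A partial order $L$ on $X$ extends a partial order $P$ on $X$ if $x\,P\,y\Rightarrow x\,L\,y$ for all $x,y\in X$. For $U\subseteq X$ and an order $P$ on $X$, $P|_U$ denotes the restriction of $P$ to $U$. For an integer $k\ge 1$, $PL^{(k)}$ denotes the set of all triples $(X,P^X,\mathcal{L}^X_k)$, where $(X,P^X)$ is a poset and $\mathcal{L}^X_k=(L^X_1,\dots,L^X_k)$ is a $k$-tuple of linear orders on $X$, each of which extends $P^X$. Let $\mathcal{X}=(X,P^X,\mathcal{L}^X_k)$ and $\mathcal{Y}=(Y,P^Y,\mathcal{L}^Y_k)$ be in $PL^{(k)}$. Write $\mathcal{X}\subseteq\mathcal{Y}$ if $X\subseteq Y$, $P^Y|_X=P^X$, and $L^Y_i|_X=L^X_i$ for all $i\in[k]=\{1,\dots,k\}$. A mapping $\pi:X\to Y$ is order preserving for $\mathcal{X}$ and $\mathcal{Y}$ if for all $x,y\in X$ and all $i\in[k]$: $x\,L^X_i\,y\Leftrightarrow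 \pi(x)\,L^Y_i\,\pi(y)$, and $x\,P^X\,y\Leftrightarrow\pi(x)\,P^Y\,\pi(y)$. An isomorphism is an order preserving bijection. A copy of $\mathcal{X}$ in $\mathcal{Y}$ is an element $\tilde{\mathcal{X}}\in PL^{(k)}$ with $\tilde{\mathcal{X}}\subseteq\mathcal{Y}$ that is isomorphic to $\mathcal{X}$; $\binom{\mathcal{Y}}{\mathcal{X}}$ denotes the set of all copies of $\mathcal{X}$ in $\mathcal{Y}$. (Equivalently, copies of $\mathcal{X}$ in $\mathcal{Y}$ correspond bijectively to order preserving mappings $X\to Y$.) *)

theory Defs
  imports Main
begin

text \<open>
  Orders are sets of pairs over an explicit ground set. The \<open>k\<close>-tuple of linear orders is a list
  of length \<open>k\<close>, so \<open>L\<^sub>i\<close> for \<open>1 \<le> i \<le> k\<close> is entry \<open>i - 1\<close> of the list. Since all relations are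
  subsets of \<open>X \<times> X\<close>, two structures are equal as HOL values iff they are equal as triples;
  hence sets of copies contain each copy exactly once.
\<close>

datatype 'a multi_ordered_set =
  Triple (ground: "'a set") (order: "'a rel") (linear_orders: "'a rel list")

definition strict_partial_order_on :: "'a set \<Rightarrow> 'a rel \<Rightarrow> bool" where
  "strict_partial_order_on X P \<longleftrightarrow> P \<subseteq> X \<times> X \<and> irrefl P \<and> trans P"

definition PL :: "nat \<Rightarrow> 'a multi_ordered_set set" where
  "PL k = {S. finite (ground S)
     \<and> strict_partial_order_on (ground S) (order S)
     \<and> length (linear_orders S) = k
     \<and> (\<forall>i<k. linear_orders S ! i \<subseteq> ground S \<times> ground S
            \<and> strict_linear_order_on (ground S) (linear_orders S ! i)
            \<and> order S \<subseteq> linear_orders S ! i)}"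

definition substructure ::
    "nat \<Rightarrow> 'a multi_ordered_set \<Rightarrow> 'a multi_ordered_set \<Rightarrow> bool" where
  "substructure k S T \<longleftrightarrow> ground S \<subseteq> ground T
     \<and> Restr (order T) (ground S) = order S
     \<and> (\<forall>i<k. Restr (linear_orders T ! i) (ground S) = linear_orders S ! i)"

definition order_preserving ::
    "nat \<Rightarrow> 'a multi_ordered_set \<Rightarrow> 'b multi_ordered_set \<Rightarrow> ('a \<Rightarrow> 'b) \<Rightarrow> bool" where
  "order_preserving k S T \<pi> \<longleftrightarrow> \<pi> ` ground S \<subseteq> ground T
     \<and> (\<forall>x\<in>ground S. \<forall>y\<in>ground S.
          (\<forall>i<k. (x, y) \<in> linear_orders S ! i \<longleftrightarrow> (\<pi> x, \<pi> y) \<in> linear_orders T ! i)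
          \<and> ((x, y) \<in> order S \<longleftrightarrow> (\<pi> x, \<pi> y) \<in> order T))"

definition isomorphic ::
    "nat \<Rightarrow> 'a multi_ordered_set \<Rightarrow> 'b multi_ordered_set \<Rightarrow> bool" where
  "isomorphic k S T \<longleftrightarrow>
     (\<exists>\<pi>. order_preserving k S T \<pi> \<and> bij_betw \<pi> (ground S) (ground T))"

text \<open>
  The set of copies of \<open>S\<close> in \<open>T\<close>. The copies live on the type of \<open>T\<close>, which may differ from the
  type of \<open>S\<close>.
\<close>

definition copies ::
    "nat \<Rightarrow> 'b multi_ordered_set \<Rightarrow> 'a multi_ordered_set \<Rightarrow> 'b multi_ordered_set set" where
  "copies k T S = {Z \<in> PL k. substructure k Z T \<and> isomorphic k Z S}"

definition monochromatic :: "('c \<Rightarrow> bool) \<Rightarrow> 'c set \<Rightarrow> bool" where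
  "monochromatic \<chi> Q \<longleftrightarrow> (\<exists>c. \<forall>Z\<in>Q. \<chi> Z = c)"

end

theory Submission
  imports Defs "HOL-Library.Countable"
begin

text \<open>
  The theorem is reduced to the Graham-Rothschild theorem (the dual Ramsey theorem) for rigid words,
  that is, for words in which the parameters make their first appearance in increasing order.

  A structure \<open>S\<close> with \<open>k\<close> linear orders is coded by its coordinates: the pairs \<open>(i, U)\<close> with \<open>i < k\<close> and \<open>U\<close>
  an up-closed set of the poset. The coordinates are linearly ordered, first by \<open>i\<close>, then by the rule that
  \<open>U\<close> precedes \<open>V\<close> if the \<open>L\<^sub>i\<close>-least element on which they differ lies in \<open>V\<close>. Let \<open>u\<close> be a rigid word
  whose letters number the coordinates. Reading off, at every position of \<open>u\<close>, the label \<open>i\<close> and the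
  truth value of \<open>a \<in> U\<close> sends each element \<open>a\<close> to a word over \<open>{..<k} \<times> bool\<close>. On all such words of the
  same length, take the pointwise order as partial order and, as \<open>i\<close>-th linear order, the lexicographic
  comparison of the letters labelled \<open>i\<close>. Every rigid \<open>u\<close> then yields an embedding of \<open>S\<close> into this
  cube (\<open>code_order_preserving\<close>).

  An embedding \<open>f\<close> of \<open>A\<close> into \<open>B\<close> maps the coordinates of \<open>B\<close> onto those of \<open>A\<close> by taking preimages of
  up-closed sets. The first coordinate with preimage \<open>V\<close> is the up-closed set generated by \<open>f ` V\<close>, and this
  makes the map rigid (\<open>restriction_word\<close>). So all copies of \<open>A\<close> within the copy of \<open>B\<close> coded by \<open>u\<close> are
  coded by compositions of \<open>u\<close> with rigid words. Colouring a rigid word by the colour of the copy of \<open>A\<close> that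
  it codes, the Graham-Rothschild theorem provides a \<open>u\<close> for which all these compositions have the same colour.
  All \<open>k\<close> linear orders are served by one word, because the labels keep their coordinates apart.

  The Graham-Rothschild theorem is proved by induction on the number of parameters. In front of its first
  parameter a word has a lead of constants; behind it, that parameter acts as one more constant. The
  induction hypothesis makes the colour depend on the lead only (\<open>lead_determines_colour\<close>), the
  Hales-Jewett theorem makes it depend on the length of the lead only
  (\<open>lead_length_determines_colour\<close>), and the pigeonhole principle finishes the step (\<open>GR_Suc\<close>). The
  Hales-Jewett theorem itself is obtained by Shelah's argument, by induction on the alphabet: one finds a
  subspace in which the colour does not distinguish two of the letters.
\<close>

section \<open>Rigid words and substitution\<close>

text \<open>
  Letters below \<open>a\<close> are constants; the letters \<open>a, a + 1, \<dots>, a + m - 1\<close> are parameters. All parameters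
  occur, and their first occurrences come in increasing order. For \<open>a = 0\<close> these are the
  restricted growth words, which encode the rigid surjections of a chain onto \<open>{..<m}\<close>. The recursion
  turns a parameter into a constant once it has occurred, so that proofs about rigid words are
  inductions on the word with \<open>a\<close> growing.
\<close>

inductive rigid :: "nat \<Rightarrow> nat \<Rightarrow> nat list \<Rightarrow> bool" where
  Nil: "rigid a 0 []"
| old: "x < a \<Longrightarrow> rigid a m w \<Longrightarrow> rigid a m (x # w)"
| new: "rigid (Suc a) m w \<Longrightarrow> rigid a (Suc m) (a # w)"

lemma rigid_letters: "rigid a m w \<Longrightarrow> set w \<subseteq> {..<a + m}"
  by (induction rule: rigid.induct) auto

lemma rigid_0_iff: "rigid a 0 w \<longleftrightarrow> set w \<subseteq> {..<a}"
proof
  show "rigid a 0 w" if "set w \<subseteq> {..<a}"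
    using that by (induction w) (auto intro: rigid.intros)
qed (use rigid_letters in fastforce)

lemma rigid_append_old: "set p \<subseteq> {..<a} \<Longrightarrow> rigid a m w \<Longrightarrow> rigid a m (p @ w)"
  by (induction p) (auto intro: rigid.intros)

lemma rigid_append: "rigid a m v \<Longrightarrow> rigid (a + m) n w \<Longrightarrow> rigid a (m + n) (v @ w)"
  by (induction rule: rigid.induct) (auto intro: rigid.intros)

lemma rigid_upt: "rigid a m [a..<a + m]"
proof (induction m arbitrary: a)
  case 0
  then show ?case by (simp add: rigid.Nil)
next
  case (Suc m)
  then show ?case
    using rigid.new[OF Suc[of "Suc a"]] by (simp add: upt_conv_Cons del: upt_Suc)
qed

lemma rigid_first_occurrence:
  "rigid a m w \<Longrightarrow> i < m \<Longrightarrow> \<exists>u v. w = u @ (a + i) # v \<and> set u \<subseteq> {..<a + i}"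
proof (induction arbitrary: i rule: rigid.induct)
  case (old x a m w)
  then obtain u v where "w = u @ (a + i) # v" "set u \<subseteq> {..<a + i}" by blast
  with old.hyps show ?case
    by (intro exI[of _ "x # u"] exI[of _ v]) auto
next
  case (new a m w)
  show ?case
  proof (cases i)
    case 0
    then show ?thesis by (intro exI[of _ "[]"] exI[of _ w]) auto
  next
    case (Suc i')
    with new obtain u v where "w = u @ (Suc a + i') # v" "set u \<subseteq> {..<Suc a + i'}"
      by (metis Suc_less_eq)
    with Suc show ?thesis
      by (intro exI[of _ "a # u"] exI[of _ v]) auto
  qed
qed simp

lemma rigidI:
  assumes "set w \<subseteq> {..<a + m}"
    and "\<And>i. i < m \<Longrightarrow> \<exists>u v. w = u @ (a + i) # v \<and> set u \<subseteq> {..<a + i}"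
  shows "rigid a m w"
  using assms
proof (induction w arbitrary: a m)
  case Nil
  have "m = 0" using Nil(2)[of 0] by (cases m) auto
  then show ?case by (simp add: rigid.Nil)
next
  case (Cons x w)
  show ?case
  proof (cases "x < a")
    case True
    have "rigid a m w"
    proof (rule Cons.IH)
      fix i assume "i < m"
      then obtain u v where uv: "x # w = u @ (a + i) # v" "set u \<subseteq> {..<a + i}"
        using Cons.prems(2) by blast
      with True have "u \<noteq> []" by auto
      then obtain u' where "u = x # u'" using uv(1) by (cases u) auto
      with uv show "\<exists>u v. w = u @ (a + i) # v \<and> set u \<subseteq> {..<a + i}" by auto
    qed (use Cons.prems in auto)
    with True show ?thesis by (rule rigid.old)
  next
    case False
    with Cons.prems(1) obtain m' where m: "m = Suc m'" by (cases m) auto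
    with Cons.prems(2)[of 0] False have x: "x = a"
      by (auto simp: Cons_eq_append_conv)
    have "rigid (Suc a) m' w"
    proof (rule Cons.IH)
      fix i assume "i < m'"
      then obtain u v where uv: "x # w = u @ (a + Suc i) # v" "set u \<subseteq> {..<a + Suc i}"
        using Cons.prems(2)[of "Suc i"] m by auto
      with x have "u \<noteq> []" by auto
      then obtain u' where "u = x # u'" using uv(1) by (cases u) auto
      with uv show "\<exists>u v. w = u @ (Suc a + i) # v \<and> set u \<subseteq> {..<Suc a + i}" by auto
    qed (use Cons.prems m in auto)
    then show ?thesis unfolding m x by (rule rigid.new)
  qed
qed

lemma rigid_split:
  assumes "rigid a (Suc m) w"
  obtains p q where "w = p @ a # q" "set p \<subseteq> {..<a}" "rigid (Suc a) m q"
proof -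
  have "\<exists>p q. w = p @ a # q \<and> set p \<subseteq> {..<a} \<and> rigid (Suc a) m q"
    using assms
  proof (induction a "Suc m" w rule: rigid.induct)
    case (old x a w)
    then obtain p q where "w = p @ a # q" "set p \<subseteq> {..<a}" "rigid (Suc a) m q" by blast
    with old.hyps(1) show ?case by (intro exI[of _ "x # p"] exI[of _ q]) auto
  next
    case (new a w)
    then show ?case by (intro exI[of _ "[]"] exI[of _ w]) auto
  qed
  then show thesis using that by blast
qed

lemma rigid_rename:
  assumes "rigid b n u" "\<And>x. x < b \<Longrightarrow> f x < d" "\<And>j. f (b + j) = d + j"
  shows "rigid d n (map f u)"
  using assms
proof (induction arbitrary: d rule: rigid.induct)
  case (new a m w)
  have "f a = d" using new.prems(2)[of 0] by simp
  moreover have "rigid (Suc d) m (map f w)"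
  proof (rule new.IH)
    show "f x < Suc d" if "x < Suc a" for x
      using new.prems(1)[of x] \<open>f a = d\<close> that by (cases "x = a") auto
    show "f (Suc a + j) = Suc d + j" for j using new.prems(2)[of "Suc j"] by simp
  qed
  ultimately show ?case by (auto intro: rigid.intros)
qed (auto intro: rigid.intros)

text \<open>
  Closure under composition. The letters that \<open>u\<close> has already seen are sent to the prefix \<open>p\<close>, the
  parameters still to come are sent to the letters of \<open>s\<close>; each new parameter of \<open>u\<close> moves one
  letter from \<open>s\<close> to \<open>p\<close>, which is why \<open>p\<close> has to be general for the induction.
\<close>

lemma rigid_map_nth:
  assumes "rigid b n u" "rigid a m s" "length s = n" "length p = b" "set p \<subseteq> {..<a}"
  shows "rigid a m (map ((!) (p @ s)) u)"
  using assms
proof (induction arbitrary: a m s p rule: rigid.induct)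
  case (old x b n w)
  then have "p ! x < a" by (metis lessThan_iff nth_mem subsetD)
  with old show ?case by (auto simp: nth_append intro: rigid.intros)
next
  case (new b n w)
  from new.prems(2) obtain y s' where s: "s = y # s'" by (cases s) auto
  from new.prems(1)[unfolded s] show ?case
  proof cases
    case old
    have "rigid a m (map ((!) ((p @ [y]) @ s')) w)"
      by (rule new.IH) (use old new.prems s in auto)
    moreover have "(p @ s) ! b = y" using new.prems s by (metis nth_append_length)
    ultimately show ?thesis using old s by (simp add: rigid.old)
  next
    case (new m')
    have "rigid (Suc a) m' (map ((!) ((p @ [y]) @ s')) w)"
      by (rule new.IH) (use new new.prems s in auto)
    moreover have "(p @ s) ! b = y" using new.prems s by (metis nth_append_length)
    ultimately show ?thesis using new s by (simp add: rigid.new)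
  qed
qed (auto simp: rigid_0_iff)

definition words :: "nat \<Rightarrow> nat \<Rightarrow> nat \<Rightarrow> nat list set" where
  "words a m n = {w. rigid a m w \<and> length w = n}"

text \<open>
  The prefix \<open>[0..<a]\<close> makes substitution fix the constants; the parameter \<open>a + j\<close> becomes \<open>s ! j\<close>.
  With this encoding, substitution is composition of maps and hence associative.
\<close>

definition subst :: "nat \<Rightarrow> nat list \<Rightarrow> nat list \<Rightarrow> nat list" where
  "subst a s u = map ((!) ([0..<a] @ s)) u"

lemma length_subst [simp]: "length (subst a s u) = length u"
  by (simp add: subst_def)

lemma subst_append: "subst a s (u @ v) = subst a s u @ subst a s v"
  by (simp add: subst_def)

lemma subst_in_words:
  "s \<in> words a m n \<Longrightarrow> u \<in> words a n N \<Longrightarrow> subst a s u \<in> words a m N"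
  unfolding words_def subst_def by (auto intro!: rigid_map_nth[where b = a and n = n])

lemma subst_subst:
  assumes "set u \<subseteq> {..<a + length v}"
  shows "subst a s (subst a v u) = subst a (subst a s v) u"
  using assms unfolding subst_def by (auto simp: nth_append)

lemma subst_upt: "length s = n \<Longrightarrow> subst a s [a..<a + n] = s"
  unfolding subst_def by (auto simp: nth_append intro!: nth_equalityI)

lemma words_subst_subst:
  "u \<in> words a n N \<Longrightarrow> v \<in> words a m n \<Longrightarrow> subst a s (subst a v u) = subst a (subst a s v) u"
  by (rule subst_subst) (use rigid_letters in \<open>auto simp: words_def\<close>)

lemma upt_in_words: "[a..<a + n] \<in> words a n n"
  by (simp add: words_def rigid_upt)

text \<open>
  The Graham-Rothschild property for words with \<open>m\<close> parameters over \<open>a\<close> constants and two colours: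
  \<open>u\<close> is an \<open>n\<close>-dimensional subspace, and the words \<open>subst a s u\<close> are its \<open>m\<close>-dimensional subspaces.
\<close>

definition GR :: "nat \<Rightarrow> nat \<Rightarrow> bool" where
  "GR a m \<longleftrightarrow> (\<forall>n. \<exists>N. \<forall>c :: nat list \<Rightarrow> bool. \<exists>u\<in>words a n N.
      \<forall>s\<in>words a m n. \<forall>t\<in>words a m n. c (subst a s u) = c (subst a t u))"

lemma GR_at: "GR a m \<Longrightarrow> \<exists>N. \<forall>c :: nat list \<Rightarrow> bool. \<exists>u\<in>words a n N.
    \<forall>s\<in>words a m n. \<forall>t\<in>words a m n. c (subst a s u) = c (subst a t u)"
  unfolding GR_def by (rule spec)

text \<open>
  Several colourings at once, in place of more colours: pass to a good subspace for one colouring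
  after the other, since a subspace of a good subspace is good.
\<close>

lemma GR_family:
  assumes "GR a m" "finite J"
  shows "\<exists>N. \<forall>c :: 'j \<Rightarrow> nat list \<Rightarrow> bool. \<exists>u\<in>words a n N. \<forall>j\<in>J.
      \<forall>s\<in>words a m n. \<forall>t\<in>words a m n. c j (subst a s u) = c j (subst a t u)"
  using assms(2)
proof (induction J)
  case empty
  then show ?case using upt_in_words by blast
next
  case (insert j J)
  obtain M where M: "\<forall>c :: 'j \<Rightarrow> nat list \<Rightarrow> bool. \<exists>u\<in>words a n M. \<forall>j\<in>J.
      \<forall>s\<in>words a m n. \<forall>t\<in>words a m n. c j (subst a s u) = c j (subst a t u)"
    using insert.IH by blast
  obtain N where N: "\<forall>c :: nat list \<Rightarrow> bool. \<exists>u\<in>words a M N.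
      \<forall>s\<in>words a m M. \<forall>t\<in>words a m M. c (subst a s u) = c (subst a t u)"
    using GR_at[OF assms(1), of M] by blast
  show ?case
  proof (intro exI[of _ N] allI)
    fix c :: "'j \<Rightarrow> nat list \<Rightarrow> bool"
    obtain u where u: "u \<in> words a M N"
      "\<forall>s\<in>words a m M. \<forall>t\<in>words a m M. c j (subst a s u) = c j (subst a t u)"
      using N[THEN spec, of "c j"] by blast
    obtain v where v: "v \<in> words a n M" "\<forall>j\<in>J. \<forall>s\<in>words a m n. \<forall>t\<in>words a m n.
        c j (subst a (subst a s v) u) = c j (subst a (subst a t v) u)"
      using M[THEN spec, of "\<lambda>j w. c j (subst a w u)"] by blast
    show "\<exists>u\<in>words a n N. \<forall>j\<in>insert j J. \<forall>s\<in>words a m n. \<forall>t\<in>words a m n.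
        c j (subst a s u) = c j (subst a t u)"
    proof (intro bexI[of _ "subst a v u"] ballI)
      show "subst a v u \<in> words a n N" using u(1) v(1) by (rule subst_in_words[rotated])
      fix i s t assume i: "i \<in> insert j J" and st: "s \<in> words a m n" "t \<in> words a m n"
      have "c i (subst a (subst a s v) u) = c i (subst a (subst a t v) u)"
      proof (cases "i = j")
        case True
        then show ?thesis using u(2) st[THEN subst_in_words, OF v(1)] by blast
      next
        case False
        then show ?thesis using v(2) i st by blast
      qed
      then show "c i (subst a s (subst a v u)) = c i (subst a t (subst a v u))"
        by (simp add: words_subst_subst[OF u(1) v(1)])
    qed
  qed
qed

section \<open>The Hales-Jewett theorem\<close>

abbreviation (input) collapse :: "nat \<Rightarrow> nat \<Rightarrow> nat" where
  "collapse a x \<equiv> if x = a then 0 else x"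

lemma words_0: "words a 0 n = {w. set w \<subseteq> {..<a} \<and> length w = n}"
  by (simp add: words_def rigid_0_iff)

lemma finite_words_0: "finite (words a 0 n)"
  unfolding words_0 by (simp add: finite_lists_length_eq)

text \<open>
  Shelah's pigeonhole argument. A parameter block runs from \<open>a\<close>s to \<open>0\<close>s with the parameter in
  between; among more blocks \<open>a\<^sup>i 0\<^sup>L\<^sup>-\<^sup>i\<close> than there are two-colourings of the remaining positions, two
  induce the same colouring, and the parameter interpolates between these two. The prefix \<open>z\<close>, of any
  prescribed length, carries along the parameters that were dealt with before; only their letter
  matters, not the block that it stands for, and so the length of \<open>z\<close> does not depend on \<open>L\<close>.
\<close>

lemma letter_insensitive_subspace:
  assumes "0 < a"
  shows "\<exists>N. \<forall>c :: nat list \<Rightarrow> bool. \<exists>u\<in>words (Suc a) n N.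
    \<forall>z\<in>words (Suc a) 0 l. \<forall>s\<in>words (Suc a) 0 n.
      c (z @ subst (Suc a) s u) = c (z @ subst (Suc a) (map (collapse a) s) u)"
proof (induction n arbitrary: l)
  case 0
  show ?case
    by (intro exI[of _ 0] allI bexI[of _ "[]"]) (auto simp: words_def rigid.Nil subst_def)
next
  case (Suc n)
  let ?b = "Suc a"
  obtain M where M: "\<forall>c :: nat list \<Rightarrow> bool. \<exists>u\<in>words ?b n M. \<forall>z\<in>words ?b 0 (Suc l). \<forall>s\<in>words ?b 0 n.
      c (z @ subst ?b s u) = c (z @ subst ?b (map (collapse a) s) u)"
    using Suc[of "Suc l"] by blast
  define W where "W = words ?b 0 l \<times> words ?b 0 M"
  have "finite W" by (simp add: W_def finite_words_0)
  define L where "L = card (Pow W)"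
  define step where "step i = replicate i a @ replicate (L - i) 0" for i
  show ?case
  proof (intro exI[of _ "L + M"] allI)
    fix c :: "nat list \<Rightarrow> bool"
    \<comment> \<open>the colouring that the \<open>i\<close>-th constant block induces on its surroundings\<close>
    define F where "F i = {(z, y). (z, y) \<in> W \<and> c (z @ step i @ y)}" for i
    have "card (F ` {..L}) \<le> L"
      unfolding L_def by (rule card_mono) (auto simp: F_def \<open>finite W\<close>)
    then have "\<not> inj_on F {..L}"
      by (intro pigeonhole) simp
    then obtain i j where ij: "i < j" "j \<le> L" "F i = F j"
      unfolding inj_on_def by (metis atMost_iff linorder_neqE_nat)
    define blk where "blk x = replicate i a @ replicate (j - i) x @ replicate (L - j) (0::nat)" for x
    have "blk 0 = step i" "blk a = step j"
      using ij by (simp_all add: blk_def step_def flip: replicate_add append_assoc)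
    have len: "length (blk x) = L" for x using ij by (simp add: blk_def)
    have swap: "c (z @ blk a @ y) = c (z @ blk 0 @ y)"
      if "z \<in> words ?b 0 l" "y \<in> words ?b 0 M" for z y
    proof -
      have "(z, y) \<in> F i \<longleftrightarrow> (z, y) \<in> F j" using ij by simp
      then show ?thesis
        using that by (simp add: F_def W_def \<open>blk 0 = step i\<close> \<open>blk a = step j\<close>)
    qed
    \<comment> \<open>in the colouring used here, the letter at position \<open>l\<close> stands for the whole block\<close>
    obtain u where u: "u \<in> words ?b n M"
      "\<And>z s. z \<in> words ?b 0 (Suc l) \<Longrightarrow> s \<in> words ?b 0 n \<Longrightarrow>
         c (take l z @ blk (z ! l) @ subst ?b s u)
         = c (take l z @ blk (z ! l) @ subst ?b (map (collapse a) s) u)"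
      using M[THEN spec, of "\<lambda>w. c (take l w @ blk (w ! l) @ drop (Suc l) w)"]
      by (auto simp: words_def nth_append)
    define f where "f x = (if x < ?b then x else Suc x)" for x
    define v where "v = blk ?b @ map f u"
    have "rigid (Suc ?b) n (map f u)"
      by (rule rigid_rename[of ?b]) (use u(1) in \<open>auto simp: f_def words_def\<close>)
    then have "rigid ?b (Suc n)
        (replicate i a @ ?b # (replicate (j - i - 1) ?b @ replicate (L - j) 0) @ map f u)"
      by (intro rigid_append_old rigid.new) auto
    moreover have "replicate (j - i) ?b = ?b # replicate (j - i - 1) ?b"
      using ij by (cases "j - i") auto
    ultimately have "rigid ?b (Suc n) v" by (simp add: v_def blk_def)
    then have v: "v \<in> words ?b (Suc n) (L + M)"
      using u(1) by (simp add: words_def v_def len)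
    have sv: "subst ?b (y # s) v = blk y @ subst ?b s u" if "length s = n" for y s
      using rigid_letters[of ?b n u] u(1) that \<open>0 < a\<close>
      by (auto simp: v_def blk_def subst_def f_def words_def nth_append nth_Cons' subset_eq
          simp del: upt_Suc)
    show "\<exists>v\<in>words ?b (Suc n) (L + M). \<forall>z\<in>words ?b 0 l. \<forall>s\<in>words ?b 0 (Suc n).
        c (z @ subst ?b s v) = c (z @ subst ?b (map (collapse a) s) v)"
    proof (intro bexI[OF _ v] ballI)
      fix z s assume z: "z \<in> words ?b 0 l" and "s \<in> words ?b 0 (Suc n)"
      then obtain y s' where s: "s = y # s'" "y < ?b" "s' \<in> words ?b 0 n"
        by (cases s) (auto simp: words_0)
      have cs: "map (collapse a) s' \<in> words ?b 0 n"
        using s(3) by (auto simp: words_0)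
      have "c (z @ subst ?b s v) = c (z @ blk y @ subst ?b s' u)"
        using s by (simp add: sv words_0)
      also have "\<dots> = c (z @ blk y @ subst ?b (map (collapse a) s') u)"
        using u(2)[of "z @ [y]" s'] z s by (auto simp: words_0 nth_append)
      also have "\<dots> = c (z @ blk (collapse a y) @ subst ?b (map (collapse a) s') u)"
        using swap[OF z subst_in_words[OF cs u(1)]] by auto
      also have "\<dots> = c (z @ subst ?b (map (collapse a) s) v)"
        using s by (simp add: sv words_0)
      finally show "c (z @ subst ?b s v) = c (z @ subst ?b (map (collapse a) s) v)" .
    qed
  qed
qed

lemma GR_if_words_unique: "\<lbrakk>\<And>n s t. s \<in> words a m n \<Longrightarrow> t \<in> words a m n \<Longrightarrow> s = t\<rbrakk> \<Longrightarrow> GR a m"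
  unfolding GR_def using upt_in_words by metis

text \<open>
  In a subspace that does not distinguish the last letter from \<open>0\<close>, a monochromatic subspace over
  the smaller alphabet stays monochromatic over the larger one.
\<close>

theorem Hales_Jewett: "GR a 0"
proof (induction a)
  case 0
  show ?case by (rule GR_if_words_unique) (auto simp: words_0)
next
  case (Suc a)
  show ?case
  proof (cases "a = 0")
    case True
    show ?thesis
    proof (rule GR_if_words_unique)
      fix n s t assume "s \<in> words (Suc a) 0 n" "t \<in> words (Suc a) 0 n"
      then show "s = t" using True
        by (auto simp: words_0 subset_eq intro!: nth_equalityI) (metis less_one nth_mem)
    qed
  next
    case False
    then have "0 < a" by simp
    let ?b = "Suc a"
    show ?thesis
      unfolding GR_def
    proof
      fix n
      obtain M where M: "\<forall>c :: nat list \<Rightarrow> bool. \<exists>u\<in>words a n M. \<forall>s\<in>words a 0 n. \<forall>t\<in>words a 0 n.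
          c (subst a s u) = c (subst a t u)"
        using GR_at[OF Suc, of n] by blast
      obtain N where N: "\<forall>c :: nat list \<Rightarrow> bool. \<exists>u\<in>words ?b M N. \<forall>z\<in>words ?b 0 0. \<forall>s\<in>words ?b 0 M.
          c (z @ subst ?b s u) = c (z @ subst ?b (map (collapse a) s) u)"
        using letter_insensitive_subspace[OF \<open>0 < a\<close>, of M 0] by blast
      show "\<exists>N. \<forall>c :: nat list \<Rightarrow> bool. \<exists>u\<in>words ?b n N. \<forall>s\<in>words ?b 0 n. \<forall>t\<in>words ?b 0 n.
          c (subst ?b s u) = c (subst ?b t u)"
      proof (intro exI[of _ N] allI)
        fix c :: "nat list \<Rightarrow> bool"
        obtain u where u: "u \<in> words ?b M N" "\<And>s. s \<in> words ?b 0 M \<Longrightarrow>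
            c (subst ?b s u) = c (subst ?b (map (collapse a) s) u)"
          using N[THEN spec, of c] by (auto simp: words_0)
        obtain v where v: "v \<in> words a n M" "\<And>s t. s \<in> words a 0 n \<Longrightarrow> t \<in> words a 0 n \<Longrightarrow>
            c (subst ?b (subst a s v) u) = c (subst ?b (subst a t v) u)"
          using M[THEN spec, of "\<lambda>w. c (subst ?b w u)"] by blast
        define f where "f x = (if x < a then x else Suc x)" for x
        \<comment> \<open>the same subspace over one more constant, so its parameters are shifted by one\<close>
        define v' where "v' = map f v"
        have v': "v' \<in> words ?b n M"
          using v(1) unfolding v'_def words_def by (auto simp: f_def intro!: rigid_rename[of a])
        have col: "map (collapse a) (subst ?b s v') = subst a (map (collapse a) s) v"
          if "s \<in> words ?b 0 n" for s
        proof -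
          have "collapse a (([0..<?b] @ s) ! f x) = ([0..<a] @ map (collapse a) s) ! x"
            if "x \<in> set v" for x
            using rigid_letters[of a n v] v(1) that \<open>s \<in> words ?b 0 n\<close> False
            by (auto simp: words_def f_def nth_append subset_eq simp del: upt_Suc)
          then show ?thesis
            unfolding subst_def v'_def map_map comp_def map_eq_conv by blast
        qed
        have eq: "c (subst ?b s (subst ?b v' u)) = c (subst ?b (subst a (map (collapse a) s) v) u)"
          and mem: "map (collapse a) s \<in> words a 0 n"
          if "s \<in> words ?b 0 n" for s
        proof -
          have "c (subst ?b s (subst ?b v' u)) = c (subst ?b (subst ?b s v') u)"
            using u(1) v' by (simp add: words_subst_subst)
          also have "\<dots> = c (subst ?b (map (collapse a) (subst ?b s v')) u)"
            by (rule u(2)) (rule subst_in_words[OF that v'])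
          finally show "c (subst ?b s (subst ?b v' u))
              = c (subst ?b (subst a (map (collapse a) s) v) u)"
            using col[OF that] by simp
          show "map (collapse a) s \<in> words a 0 n"
            using that False by (auto simp: words_0 subset_eq less_Suc_eq)
        qed
        show "\<exists>u\<in>words ?b n N. \<forall>s\<in>words ?b 0 n. \<forall>t\<in>words ?b 0 n.
            c (subst ?b s u) = c (subst ?b t u)"
        proof (intro bexI[OF _ subst_in_words[OF v' u(1)]] ballI)
          fix s t assume st: "s \<in> words ?b 0 n" "t \<in> words ?b 0 n"
          show "c (subst ?b s (subst ?b v' u)) = c (subst ?b t (subst ?b v' u))"
            unfolding eq[OF st(1)] eq[OF st(2)] by (intro v(2) mem st)
        qed
      qed
    qed
  qed
qed

section \<open>The Graham-Rothschild theorem\<close>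

text \<open>
  A word with at least one parameter is \<open>p @ a # q\<close>, where \<open>p\<close> consists of constants and \<open>q\<close> is a word
  with one parameter less over the alphabet enlarged by \<open>a\<close>. Its lead is \<open>p\<close>.
\<close>

abbreviation lead :: "nat \<Rightarrow> nat list \<Rightarrow> nat list" where
  "lead a w \<equiv> takeWhile (\<lambda>x. x < a) w"

lemma lead_append: "set p \<subseteq> {..<a} \<Longrightarrow> lead a (p @ a # q) = p"
  by (simp add: takeWhile_append1 takeWhile_append2 subset_eq)

lemma words_split:
  assumes "w \<in> words a (Suc m) n"
  obtains p q where "w = p @ a # q" "set p \<subseteq> {..<a}" "lead a w = p" "length p < n"
    "q \<in> words (Suc a) m (n - Suc (length p))"
proof -
  from assms obtain p q where "w = p @ a # q" "set p \<subseteq> {..<a}" "rigid (Suc a) m q"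
    by (auto simp: words_def elim: rigid_split)
  with assms show thesis
    by (intro that[of p q]) (auto simp: words_def lead_append)
qed

lemma words_join:
  "set p \<subseteq> {..<a} \<Longrightarrow> q \<in> words (Suc a) m k \<Longrightarrow> p @ a # q \<in> words a (Suc m) (length p + Suc k)"
  by (auto simp: words_def intro: rigid_append_old rigid.new)

lemma subst_Cons: "subst a s (x # u) = ([0..<a] @ s) ! x # subst a s u"
  by (simp add: subst_def)

lemma subst_cong_prefix:
  "set u \<subseteq> {..<a + length p} \<Longrightarrow> subst a (p @ q) u = subst a p u"
  unfolding subst_def by (auto simp: nth_append)

lemma subst_words_letters:
  "set u \<subseteq> {..<a + length p} \<Longrightarrow> set p \<subseteq> {..<a} \<Longrightarrow> set (subst a p u) \<subseteq> {..<a}"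
  using subst_in_words[of p a 0 "length p" u]
  unfolding subst_def by (auto simp: nth_append subset_eq)

text \<open>
  In \<open>subst a (p @ a # q) u\<close>, the first \<open>a\<close> arises where \<open>u\<close> has its parameter number \<open>length p\<close> for the
  first time. Hence the lead depends on \<open>u\<close> and \<open>p\<close> only, and its length on \<open>u\<close> and \<open>length p\<close> only.
\<close>

lemma lead_subst:
  assumes "set p \<subseteq> {..<a}" "rigid a n u" "length p < n"
  shows "lead a (subst a (p @ a # q) u) = subst a p (lead (a + length p) u)"
proof -
  obtain u1 u2 where u: "u = u1 @ (a + length p) # u2" "set u1 \<subseteq> {..<a + length p}"
    using rigid_first_occurrence[OF assms(2,3)] by blast
  have "subst a (p @ a # q) u = subst a p u1 @ a # subst a (p @ a # q) u2"
    unfolding u(1) subst_append subst_Cons subst_cong_prefix[OF u(2)]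
    by (simp add: nth_append)
  with u assms(1) show ?thesis
    by (simp add: lead_append subst_words_letters)
qed

text \<open>
  The leads are treated in order of their length. For leads of length \<open>j\<close>, the first \<open>j + 1\<close>
  parameters are kept, and the rest is replaced by a subspace in which the colour of \<open>p @ a # q\<close> does not
  depend on \<open>q\<close>, for all finitely many \<open>p\<close> of length \<open>j\<close> at once. Words with shorter leads keep their
  leads, so that what was achieved for them is preserved.
\<close>

lemma lead_determines_colour:
  assumes "GR (Suc a) m"
  shows "\<exists>N. \<forall>c :: nat list \<Rightarrow> bool. \<exists>u\<in>words a n N.
    \<forall>s\<in>words a (Suc m) n. \<forall>t\<in>words a (Suc m) n.
      lead a s = lead a t \<and> length (lead a s) < j \<longrightarrow> c (subst a s u) = c (subst a t u)"
proof (induction j arbitrary: n)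
  case 0
  show ?case
    by (intro exI[of _ n] allI bexI[of _ "[a..<a + n]"]) (simp_all add: upt_in_words)
next
  case (Suc j)
  show ?case
  proof (cases "n \<le> j")
    case True
    have "length (lead a s) < Suc j \<longleftrightarrow> length (lead a s) < j" if "s \<in> words a (Suc m) n" for s
      using that True by (elim words_split) simp
    then show ?thesis using Suc[of n] by (simp cong: ball_cong)
  next
    case False
    define n' where "n' = n - Suc j"
    have n: "n = j + Suc n'" using False by (simp add: n'_def)
    obtain N' where N': "\<forall>c :: nat list \<Rightarrow> nat list \<Rightarrow> bool. \<exists>v\<in>words (Suc a) n' N'.
        \<forall>p\<in>words a 0 j. \<forall>s\<in>words (Suc a) m n'. \<forall>t\<in>words (Suc a) m n'.
          c p (subst (Suc a) s v) = c p (subst (Suc a) t v)"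
      using GR_family[OF assms finite_words_0] by blast
    define M where "M = j + Suc N'"
    obtain N where N: "\<forall>c :: nat list \<Rightarrow> bool. \<exists>u\<in>words a M N.
      \<forall>s\<in>words a (Suc m) M. \<forall>t\<in>words a (Suc m) M.
      lead a s = lead a t \<and> length (lead a s) < j \<longrightarrow> c (subst a s u) = c (subst a t u)"
      using Suc[of M] by blast
    show ?thesis
    proof (intro exI[of _ N] allI)
      fix c :: "nat list \<Rightarrow> bool"
      obtain u where u: "u \<in> words a M N" and ucol:
        "\<And>s t. s \<in> words a (Suc m) M \<Longrightarrow> t \<in> words a (Suc m) M \<Longrightarrow>
          lead a s = lead a t \<Longrightarrow> length (lead a s) < j \<Longrightarrow> c (subst a s u) = c (subst a t u)"
        using N[THEN spec, of c] by blast
      obtain v where v: "v \<in> words (Suc a) n' N'" and vcol: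
        "\<And>p s t. p \<in> words a 0 j \<Longrightarrow> s \<in> words (Suc a) m n' \<Longrightarrow> t \<in> words (Suc a) m n' \<Longrightarrow>
          c (subst a (p @ a # subst (Suc a) s v) u) = c (subst a (p @ a # subst (Suc a) t v) u)"
        using N'[THEN spec, of "\<lambda>p q. c (subst a (p @ a # q) u)"] by blast
      \<comment> \<open>the parameter \<open>a\<close> of \<open>a # v\<close> becomes parameter number \<open>j\<close>, as the first \<open>j\<close> ones are kept in front;
        the constant \<open>a\<close> of \<open>v\<close> is that same parameter\<close>
      define f where "f x = (if x < a then x else x + j)" for x
      define w where "w = [a..<a + j] @ map f (a # v)"
      have fv: "rigid (a + j) (Suc n') (map f (a # v))"
        by (rule rigid_rename[of a]) (use v in \<open>auto simp: f_def words_def intro: rigid.new\<close>)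
      have w: "w \<in> words a n M"
        using rigid_append[OF rigid_upt fv] v
        unfolding w_def n M_def words_def by simp
      show "\<exists>u\<in>words a n N. \<forall>s\<in>words a (Suc m) n. \<forall>t\<in>words a (Suc m) n.
        lead a s = lead a t \<and> length (lead a s) < Suc j \<longrightarrow> c (subst a s u) = c (subst a t u)"
      proof (intro bexI[OF _ subst_in_words[OF w u]] ballI impI)
        fix s t assume s: "s \<in> words a (Suc m) n" and t: "t \<in> words a (Suc m) n"
          and *: "lead a s = lead a t \<and> length (lead a s) < Suc j"
        obtain p q where pq: "s = p @ a # q" "set p \<subseteq> {..<a}" "lead a s = p"
          "length p < n" "q \<in> words (Suc a) m (n - Suc (length p))"
          using s by (rule words_split)
        obtain q' where q': "t = p @ a # q'" "q' \<in> words (Suc a) m (n - Suc (length p))"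
          using t * pq(3) by (metis words_split)
        have "c (subst a (subst a s w) u) = c (subst a (subst a t w) u)"
        proof (cases "length p = j")
          case True
          have eq: "subst a (p @ a # r) w = p @ a # subst (Suc a) r v"
            if "r \<in> words (Suc a) m n'" for r
          proof -
            have "subst a (p @ a # r) [a..<a + j] = p"
              using subst_cong_prefix[of "[a..<a+j]" a p] subst_upt[of p j a] True
              by (auto simp: subset_eq)
            moreover have "subst a (p @ a # r) (map f v) = subst (Suc a) r v"
              using True by (auto simp: subst_def f_def nth_append nth_Cons' simp del: upt_Suc)
            moreover have "subst a (p @ a # r) [f a] = [a]"
              using True by (simp add: subst_def f_def nth_append)
            ultimately show ?thesis
              unfolding w_def subst_append
              by (metis append_Cons append_Nil list.simps(9) subst_append)
          qed
          show ?thesis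
            using pq q' True n vcol[of p q q'] by (simp add: eq words_0)
        next
          case False
          then have "length p < j" using *[THEN conjunct2] unfolding pq(3) by linarith
          then have "[a..<a + j] = [a..<a + length p] @ [a + length p..<a + j]"
            using upt_add_eq_append[of a "a + length p" "j - length p"] by simp
          also have "[a + length p..<a + j] = (a + length p) # [a + Suc (length p)..<a + j]"
            using \<open>length p < j\<close> by (simp add: upt_conv_Cons)
          finally have "w = [a..<a + length p] @ (a + length p) # [a + Suc (length p)..<a + j] @ map f (a # v)"
            unfolding w_def by simp
          then have "lead (a + length p) w = [a..<a + length p]"
            by (simp add: lead_append subset_eq)
          then have "lead a (subst a (p @ a # r) w) = p" for r
            using lead_subst[of p a n w r] w pq by (simp add: words_def subst_upt)
          then show ?thesis
            using ucol[OF subst_in_words[OF s w] subst_in_words[OF t w]] pq(1) q'(1) \<open>length p < j\<close>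
            by simp
        qed
        then show "c (subst a s (subst a w u)) = c (subst a t (subst a w u))"
          by (simp add: words_subst_subst[OF u w])
      qed
    qed
  qed
qed

text \<open>
  Once the colour is a function of the lead, the Hales-Jewett theorem can make it constant on the leads of
  one length. This is done from the longest leads to the shortest: compressing the first \<open>M\<close>
  parameters to \<open>n\<close> and keeping the others sends leads of one length \<open>> n\<close> to leads of one length \<open>> M\<close>,
  which are settled by induction, and leads of length \<open>n\<close> to leads of length \<open>M\<close>.
\<close>

lemma lead_length_determines_colour:
  "\<exists>N. \<forall>c :: nat list \<Rightarrow> bool.
    (\<forall>s\<in>words a (Suc m) N. \<forall>t\<in>words a (Suc m) N. lead a s = lead a t \<longrightarrow> c s = c t) \<longrightarrow>
    (\<exists>u\<in>words a (n + d) N. \<forall>s\<in>words a (Suc m) (n + d). \<forall>t\<in>words a (Suc m) (n + d).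
      length (lead a s) = length (lead a t) \<and> n \<le> length (lead a s)
      \<longrightarrow> c (subst a s u) = c (subst a t u))"
proof (induction d arbitrary: n)
  case 0
  have "\<not> n \<le> length (lead a s)" if "s \<in> words a (Suc m) n" for s
    using that by (elim words_split) simp
  then show ?case
    by (intro exI[of _ n] allI impI bexI[of _ "[a..<a + n]"]) (auto simp: upt_in_words)
next
  case (Suc d)
  obtain M where M: "\<forall>c :: nat list \<Rightarrow> bool. \<exists>u\<in>words a n M. \<forall>s\<in>words a 0 n. \<forall>t\<in>words a 0 n.
      c (subst a s u) = c (subst a t u)"
    using GR_at[OF Hales_Jewett, of a n] by blast
  obtain N where N: "\<forall>c :: nat list \<Rightarrow> bool.
    (\<forall>s\<in>words a (Suc m) N. \<forall>t\<in>words a (Suc m) N. lead a s = lead a t \<longrightarrow> c s = c t) \<longrightarrow>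
    (\<exists>u\<in>words a (Suc M + d) N. \<forall>s\<in>words a (Suc m) (Suc M + d). \<forall>t\<in>words a (Suc m) (Suc M + d).
      length (lead a s) = length (lead a t) \<and> Suc M \<le> length (lead a s)
      \<longrightarrow> c (subst a s u) = c (subst a t u))"
    using Suc[of "Suc M"] by blast
  show ?case
  proof (intro exI[of _ N] allI impI)
    fix c :: "nat list \<Rightarrow> bool"
    assume c: "\<forall>s\<in>words a (Suc m) N. \<forall>t\<in>words a (Suc m) N. lead a s = lead a t \<longrightarrow> c s = c t"
    obtain u where u: "u \<in> words a (Suc M + d) N" and ucol:
      "\<And>s t. s \<in> words a (Suc m) (Suc M + d) \<Longrightarrow> t \<in> words a (Suc m) (Suc M + d) \<Longrightarrow>
        length (lead a s) = length (lead a t) \<Longrightarrow> Suc M \<le> length (lead a s) \<Longrightarrow>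
        c (subst a s u) = c (subst a t u)"
      using N[THEN spec, of c] c by blast
    have lead_col: "c (subst a s u) = c (subst a t u)"
      if s: "s \<in> words a (Suc m) (Suc M + d)" and t: "t \<in> words a (Suc m) (Suc M + d)"
        and st: "lead a s = lead a t" for s t
    proof -
      obtain p q where p: "s = p @ a # q" "set p \<subseteq> {..<a}" "lead a s = p" "length p < Suc M + d"
        using s by (rule words_split)
      obtain q' where "t = p @ a # q'" using t st p(3) by (metis words_split)
      then have "lead a (subst a s u) = lead a (subst a t u)"
        using p u by (simp add: lead_subst[where n = "Suc M + d"] words_def)
      then show ?thesis using c subst_in_words[OF s u] subst_in_words[OF t u] by blast
    qed
    \<comment> \<open>the colour of a word with lead of length \<open>M\<close> does not depend on the rest, so any valid rest
      may serve to read it off\<close>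
    define q0 where "q0 = (SOME q. q \<in> words (Suc a) m d)"
    obtain w where w: "w \<in> words a n M" and wcol:
      "\<And>s t. s \<in> words a 0 n \<Longrightarrow> t \<in> words a 0 n \<Longrightarrow>
        c (subst a (subst a s w @ a # q0) u) = c (subst a (subst a t w @ a # q0) u)"
      using M[THEN spec, of "\<lambda>x. c (subst a (x @ a # q0) u)"] by blast
    define v where "v = w @ (a + n) # [a + Suc n..<a + n + Suc d]"
    have "v = w @ [a + n..<a + n + Suc d]" by (simp add: v_def upt_conv_Cons)
    then have v: "v \<in> words a (n + Suc d) (Suc M + d)"
      using rigid_append[OF _ rigid_upt, of a n w "Suc d"] w
      by (simp add: words_def del: upt_Suc)
    have wl: "set w \<subseteq> {..<a + n}" using w rigid_letters by (auto simp: words_def)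
    show "\<exists>u\<in>words a (n + Suc d) N.
      \<forall>s\<in>words a (Suc m) (n + Suc d). \<forall>t\<in>words a (Suc m) (n + Suc d).
      length (lead a s) = length (lead a t) \<and> n \<le> length (lead a s)
      \<longrightarrow> c (subst a s u) = c (subst a t u)"
    proof (intro bexI[OF _ subst_in_words[OF v u]] ballI impI)
      fix s t assume s: "s \<in> words a (Suc m) (n + Suc d)" and t: "t \<in> words a (Suc m) (n + Suc d)"
        and *: "length (lead a s) = length (lead a t) \<and> n \<le> length (lead a s)"
      obtain p q where p: "s = p @ a # q" "set p \<subseteq> {..<a}" "lead a s = p" "length p < n + Suc d"
        "q \<in> words (Suc a) m (n + Suc d - Suc (length p))"
        using s by (rule words_split)
      obtain p' q' where p': "t = p' @ a # q'" "set p' \<subseteq> {..<a}" "lead a t = p'"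
        using t by (rule words_split)
      have len: "length p' = length p" "n \<le> length p" using * p p' by simp_all
      note lead_v = lead_subst[of _ a "n + Suc d" v]
      have "c (subst a (subst a s v) u) = c (subst a (subst a t v) u)"
      proof (cases "length p = n")
        case True
        have "lead (a + n) v = w" unfolding v_def using wl by (rule lead_append)
        then have leads: "lead a (subst a s v) = subst a p w" "lead a (subst a t v) = subst a p' w"
          using lead_v v p p' len True by (simp_all add: words_def)
        have "q \<in> words (Suc a) m d" using p(5) True by simp
        then have q0: "q0 \<in> words (Suc a) m d" unfolding q0_def by (rule someI)
        have pw: "p \<in> words a 0 n" "p' \<in> words a 0 n" using p p' len True by (auto simp: words_0)
        have sw: "set (subst a x w) \<subseteq> {..<a}" "length (subst a x w) = M" if "x \<in> words a 0 n" for x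
          using subst_in_words[OF that w] by (auto simp: words_0)
        have join: "subst a x w @ a # q0 \<in> words a (Suc m) (Suc M + d)"
          "lead a (subst a x w @ a # q0) = subst a x w" if "x \<in> words a 0 n" for x
          using words_join[OF sw(1) q0, of x] sw[OF that] that by (simp_all add: lead_append)
        have "c (subst a (subst a s v) u) = c (subst a (subst a p w @ a # q0) u)"
          by (rule lead_col[OF subst_in_words[OF s v] join(1)[OF pw(1)]])
            (simp add: leads join(2)[OF pw(1)])
        also have "\<dots> = c (subst a (subst a p' w @ a # q0) u)"
          by (rule wcol[OF pw])
        also have "\<dots> = c (subst a (subst a t v) u)"
          by (rule lead_col[OF join(1)[OF pw(2)] subst_in_words[OF t v]])
            (simp add: leads join(2)[OF pw(2)])
        finally show ?thesis .
      next
        case False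
        then have "n < length p" using len by simp
        have eq: "length (lead a (subst a s v)) = length (lead (a + length p) v)"
          "length (lead a (subst a t v)) = length (lead (a + length p) v)"
          using lead_v v p p' len by (simp_all add: words_def)
        have "lead (a + length p) v = (w @ [a + n]) @ lead (a + length p) [a + Suc n..<a + n + Suc d]"
          unfolding v_def using wl \<open>n < length p\<close>
          by (subst takeWhile_append2) (auto simp: subset_eq)
        then have "Suc M \<le> length (lead (a + length p) v)"
          using w by (simp add: words_def)
        then show ?thesis
          using eq by (intro ucol subst_in_words[OF s v] subst_in_words[OF t v]) simp_all
      qed
      then show "c (subst a s (subst a v u)) = c (subst a t (subst a v u))"
        by (simp add: words_subst_subst[OF u v])
    qed
  qed
qed

text \<open>
  The positions marked \<open>True\<close> receive the new parameters in turn, the others the constant \<open>0\<close>. Substitution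
  into such a word puts the end of the lead at a marked position.
\<close>

fun spread :: "nat \<Rightarrow> bool list \<Rightarrow> nat list" where
  "spread b [] = []"
| "spread b (x # xs) = (if x then b # spread (Suc b) xs else 0 # spread b xs)"

lemma length_spread: "length (spread b xs) = length xs"
  by (induction xs arbitrary: b) auto

lemma rigid_spread: "0 < b \<Longrightarrow> rigid b (length (filter id xs)) (spread b xs)"
  by (induction xs arbitrary: b) (auto intro: rigid.intros)

lemma lead_spread:
  assumes "0 < b" "length r = b" "set (r @ p) \<subseteq> {..<a}" "length p < length (filter id xs)"
  shows "\<exists>i<length xs. xs ! i \<and> length (lead a (map ((!) (r @ p @ a # q)) (spread b xs))) = i"
  using assms
proof (induction xs arbitrary: b r p)
  case (Cons x xs)
  show ?case
  proof (cases x)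
    case False
    have "r ! 0 < a" using Cons.prems by (metis Un_iff lessThan_iff nth_mem set_append subsetD)
    then show ?thesis
      using False Cons.IH[of b r p] Cons.prems by (force simp: nth_append)
  next
    case True
    show ?thesis
    proof (cases p)
      case Nil
      then show ?thesis using True Cons.prems
        by (intro exI[of _ 0]) (simp add: nth_append)
    next
      case (Cons y p')
      then show ?thesis
        using True Cons.prems Cons.IH[of "Suc b" "r @ [y]" p'] by (force simp: nth_append)
    qed
  qed
qed simp

lemma half_of_colour:
  fixes f :: "nat \<Rightarrow> bool"
  obtains xs e where "length xs = 2 * n" "length (filter id xs) = n"
    "\<And>i. i < 2 * n \<Longrightarrow> xs ! i \<Longrightarrow> f i = e"
proof -
  let ?A = "\<lambda>e. {i. i < 2 * n \<and> f i = e}"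
  have "{..<2 * n} = ?A True \<union> ?A False" by auto
  then have "2 * n \<le> card (?A True) + card (?A False)"
    using card_Un_le[of "?A True" "?A False"] by (metis card_lessThan)
  then have "n \<le> card (?A True) \<or> n \<le> card (?A False)" by linarith
  then obtain e where "n \<le> card (?A e)" by blast
  then obtain S where S: "S \<subseteq> ?A e" "card S = n"
    by (metis obtain_subset_with_card_n)
  define xs where "xs = map (\<lambda>i. i \<in> S) [0..<2 * n]"
  have "{i. i < length xs \<and> id (xs ! i)} = S" using S(1) by (auto simp: xs_def)
  then have "length (filter id xs) = n"
    by (simp add: length_filter_conv_card S(2))
  moreover have "f i = e" if "i < 2 * n" "xs ! i" for i
    using that S(1) by (auto simp: xs_def)
  ultimately show thesis by (intro that[of xs e]) (simp_all add: xs_def)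
qed

text \<open>
  After the two preceding reductions in a subspace of dimension \<open>2 * n\<close> the colour depends only on
  the length of the lead. At least \<open>n\<close> of the \<open>2 * n\<close> lengths have the same colour, and parameters
  placed at just these positions leave no other length.
\<close>

lemma GR_Suc:
  assumes "0 < a" "GR (Suc a) m"
  shows "GR a (Suc m)"
  unfolding GR_def
proof
  fix n
  obtain M where M: "\<forall>c :: nat list \<Rightarrow> bool.
    (\<forall>s\<in>words a (Suc m) M. \<forall>t\<in>words a (Suc m) M. lead a s = lead a t \<longrightarrow> c s = c t) \<longrightarrow>
    (\<exists>u\<in>words a (0 + 2 * n) M. \<forall>s\<in>words a (Suc m) (0 + 2 * n). \<forall>t\<in>words a (Suc m) (0 + 2 * n).
      length (lead a s) = length (lead a t) \<and> 0 \<le> length (lead a s)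
      \<longrightarrow> c (subst a s u) = c (subst a t u))"
    using lead_length_determines_colour[where n = 0 and d = "2 * n"] by (rule exE)
  obtain N where N: "\<forall>c :: nat list \<Rightarrow> bool. \<exists>u\<in>words a M N.
    \<forall>s\<in>words a (Suc m) M. \<forall>t\<in>words a (Suc m) M.
      lead a s = lead a t \<and> length (lead a s) < M \<longrightarrow> c (subst a s u) = c (subst a t u)"
    using lead_determines_colour[OF assms(2), of M M] by blast
  show "\<exists>N. \<forall>c :: nat list \<Rightarrow> bool. \<exists>u\<in>words a n N.
    \<forall>s\<in>words a (Suc m) n. \<forall>t\<in>words a (Suc m) n. c (subst a s u) = c (subst a t u)"
  proof (intro exI[of _ N] allI)
    fix c :: "nat list \<Rightarrow> bool"
    have short: "length (lead a s) < M" if "s \<in> words a (Suc m) M" for s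
      using that by (elim words_split) simp
    obtain u where u: "u \<in> words a M N" and ucol0:
      "\<And>s t. s \<in> words a (Suc m) M \<Longrightarrow> t \<in> words a (Suc m) M \<Longrightarrow>
        lead a s = lead a t \<Longrightarrow> length (lead a s) < M \<Longrightarrow> c (subst a s u) = c (subst a t u)"
      using N[THEN spec, of c] by blast
    have ucol: "\<forall>s\<in>words a (Suc m) M. \<forall>t\<in>words a (Suc m) M.
        lead a s = lead a t \<longrightarrow> c (subst a s u) = c (subst a t u)"
      by (intro ballI impI ucol0 short)
    obtain v where v: "v \<in> words a (2 * n) M" and vcol:
      "\<And>s t. s \<in> words a (Suc m) (2 * n) \<Longrightarrow> t \<in> words a (Suc m) (2 * n) \<Longrightarrow>
        length (lead a s) = length (lead a t) \<Longrightarrow>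
        c (subst a (subst a s v) u) = c (subst a (subst a t v) u)"
      using M[THEN spec, of "\<lambda>w. c (subst a w u)", THEN mp, OF ucol]
      unfolding add_0 by blast
    define f where "f i \<longleftrightarrow> (\<exists>s\<in>words a (Suc m) (2 * n).
      length (lead a s) = i \<and> c (subst a (subst a s v) u))" for i
    have f: "c (subst a (subst a s v) u) = f (length (lead a s))" if "s \<in> words a (Suc m) (2 * n)" for s
      using vcol that unfolding f_def by blast
    obtain xs e where xs: "length xs = 2 * n" "length (filter id xs) = n"
      "\<And>i. i < 2 * n \<Longrightarrow> xs ! i \<Longrightarrow> f i = e"
      by (rule half_of_colour[of n f]) blast
    define w where "w = spread a xs"
    have w: "w \<in> words a n (2 * n)"
      using rigid_spread[OF assms(1), of xs] xs by (simp add: w_def words_def length_spread)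
    have col: "c (subst a (subst a (subst a s w) v) u) = e" if s: "s \<in> words a (Suc m) n" for s
    proof -
      obtain p q where p: "s = p @ a # q" "set p \<subseteq> {..<a}" "length p < n"
        using s by (rule words_split)
      then have "set ([0..<a] @ p) \<subseteq> {..<a}" by auto
      then obtain i where "i < length xs" "xs ! i" "length (lead a (subst a s w)) = i"
        using lead_spread[OF assms(1), of "[0..<a]" p a xs q] xs p
        by (auto simp: subst_def w_def)
      then show ?thesis using f[OF subst_in_words[OF s w]] xs by simp
    qed
    note vw = subst_in_words[OF w v]
    show "\<exists>u\<in>words a n N. \<forall>s\<in>words a (Suc m) n. \<forall>t\<in>words a (Suc m) n.
        c (subst a s u) = c (subst a t u)"
      by (intro bexI[OF _ subst_in_words[OF vw u]] ballI)
        (simp add: words_subst_subst[OF u vw] words_subst_subst[OF v w] col)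
  qed
qed

lemma GR_pos: "0 < a \<Longrightarrow> GR a m"
  by (induction m arbitrary: a) (simp_all add: Hales_Jewett GR_Suc)

lemma subst_0_Cons:
  "subst 0 (0 # s) (0 # u) = 0 # subst 1 s u"
  by (simp add: subst_def)

text \<open>
  Without constants, a rigid word with a parameter starts with the letter \<open>0\<close>, which may as well be regarded
  as a constant.
\<close>

theorem Graham_Rothschild: "GR a m"
proof (cases "a = 0 \<and> m \<noteq> 0")
  case False
  then show ?thesis using GR_pos Hales_Jewett by (metis gr0I)
next
  case True
  then obtain m' where [simp]: "a = 0" "m = Suc m'" by (auto simp: gr0_conv_Suc)
  have first: "\<exists>s'\<in>words 1 m' (n - 1). s = 0 # s'" if "s \<in> words 0 (Suc m') n" for s n
  proof -
    from that obtain p q where "s = p @ 0 # q" "set p \<subseteq> {..<0}" "q \<in> words (Suc 0) m' (n - Suc (length p))"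
      by (rule words_split)
    moreover from this(2) have "p = []" by (cases p) auto
    ultimately show ?thesis by simp
  qed
  show ?thesis
    unfolding GR_def
  proof
    fix n
    obtain N where N: "\<forall>c :: nat list \<Rightarrow> bool. \<exists>u\<in>words 1 (n - 1) N.
        \<forall>s\<in>words 1 m' (n - 1). \<forall>t\<in>words 1 m' (n - 1). c (subst 1 s u) = c (subst 1 t u)"
      using GR_at[OF GR_pos[OF zero_less_one], where m = m' and n = "n - 1"] by (rule exE)
    show "\<exists>N. \<forall>c :: nat list \<Rightarrow> bool. \<exists>u\<in>words a n N.
        \<forall>s\<in>words a m n. \<forall>t\<in>words a m n. c (subst a s u) = c (subst a t u)"
    proof (cases n)
      case 0
      then show ?thesis using first[of _ 0] upt_in_words[of a 0]
        by (auto simp: words_def)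
    next
      case (Suc n')
      show ?thesis
      proof (intro exI[of _ "Suc N"] allI)
        fix c :: "nat list \<Rightarrow> bool"
        obtain u where u: "u \<in> words 1 (n - 1) N" "\<And>s t. s \<in> words 1 m' (n - 1) \<Longrightarrow>
            t \<in> words 1 m' (n - 1) \<Longrightarrow> c (0 # subst 1 s u) = c (0 # subst 1 t u)"
          using N[THEN spec, of "\<lambda>w. c (0 # w)"] by blast
        have "0 # u \<in> words a n (Suc N)"
          using u(1) Suc by (auto simp: words_def intro: rigid.new)
        moreover have "c (subst a s (0 # u)) = c (subst a t (0 # u))"
          if st: "s \<in> words a m n" "t \<in> words a m n" for s t
        proof -
          obtain s' t' where "s = 0 # s'" "t = 0 # t'" "s' \<in> words 1 m' (n - 1)" "t' \<in> words 1 m' (n - 1)"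
            using first[of s n] first[of t n] st by auto
          then show ?thesis using u(2)[of s' t'] by (simp only: subst_0_Cons \<open>a = 0\<close>)
        qed
        ultimately show "\<exists>u\<in>words a n (Suc N).
            \<forall>s\<in>words a m n. \<forall>t\<in>words a m n. c (subst a s u) = c (subst a t u)" by blast
      qed
    qed
  qed
qed

section \<open>Enumerations and rigid words\<close>

lemma finite_linear_enumeration:
  fixes lt :: "'q \<Rightarrow> 'q \<Rightarrow> bool"
  assumes "finite Q"
    and irrefl: "\<And>x. x \<in> Q \<Longrightarrow> \<not> lt x x"
    and trans: "\<And>x y z. x \<in> Q \<Longrightarrow> y \<in> Q \<Longrightarrow> z \<in> Q \<Longrightarrow> lt x y \<Longrightarrow> lt y z \<Longrightarrow> lt x z"
    and total: "\<And>x y. x \<in> Q \<Longrightarrow> y \<in> Q \<Longrightarrow> x \<noteq> y \<Longrightarrow> lt x y \<or> lt y x"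
  obtains e where "bij_betw e {..<card Q} Q"
    "\<And>i j. i < card Q \<Longrightarrow> j < card Q \<Longrightarrow> lt (e i) (e j) \<longleftrightarrow> i < j"
proof -
  define rank where "rank q = card {x \<in> Q. lt x q}" for q
  have mono: "rank x < rank y" if "x \<in> Q" "y \<in> Q" "lt x y" for x y
    unfolding rank_def using that \<open>finite Q\<close>
    by (intro psubset_card_mono) (auto dest: trans irrefl)
  have inj: "inj_on rank Q"
    by (rule inj_onI) (metis mono total less_irrefl)
  have "rank q < card Q" if "q \<in> Q" for q
    unfolding rank_def using that \<open>finite Q\<close> by (intro psubset_card_mono) (auto dest: irrefl)
  then have "rank ` Q = {..<card Q}"
    by (intro card_subset_eq) (auto simp: card_image[OF inj])
  with inj have bij: "bij_betw rank Q {..<card Q}" by (simp add: bij_betw_def)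
  define e where "e = inv_into Q rank"
  have e: "e i \<in> Q" "rank (e i) = i" if "i < card Q" for i
    using that bij unfolding e_def bij_betw_def by (auto intro: inv_into_into f_inv_into_f)
  show thesis
  proof (rule that)
    show "bij_betw e {..<card Q} Q"
      unfolding e_def by (rule bij_betw_inv_into[OF bij])
    show "lt (e i) (e j) \<longleftrightarrow> i < j" if "i < card Q" "j < card Q" for i j
      using that e mono[of "e i" "e j"] mono[of "e j" "e i"] total[of "e i" "e j"] irrefl[of "e i"]
      by (metis less_asym less_irrefl)
  qed
qed

text \<open>
  A map between finite chains is rigid if the first point that it sends to \<open>V\<close> comes after points
  with smaller values only. Written as a word in the ranks, it is then a rigid word.
\<close>

lemma rigid_word_of_projection:
  assumes A: "bij_betw eA {..<m} QA" "\<And>i j. i < m \<Longrightarrow> j < m \<Longrightarrow> ltA (eA i) (eA j) \<longleftrightarrow> i < j"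
    and B: "bij_betw eB {..<n} QB" "\<And>i j. i < n \<Longrightarrow> j < n \<Longrightarrow> ltB (eB i) (eB j) \<longleftrightarrow> i < j"
    and r: "\<And>U. U \<in> QB \<Longrightarrow> r U \<in> QA"
    and first: "\<And>V. V \<in> QA \<Longrightarrow> \<exists>U\<in>QB. r U = V \<and> (\<forall>U'\<in>QB. ltB U' U \<longrightarrow> ltA (r U') V)"
  obtains s where "s \<in> words 0 m n" "\<And>j. j < n \<Longrightarrow> eA (s ! j) = r (eB j)"
proof -
  define s where "s = map (\<lambda>j. inv_into {..<m} eA (r (eB j))) [0..<n]"
  have eB: "eB j \<in> QB" if "j < n" for j
    using B(1) that by (auto simp: bij_betw_def)
  have s: "s ! j < m" "eA (s ! j) = r (eB j)" if "j < n" for j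
  proof -
    have "r (eB j) \<in> eA ` {..<m}" using r[OF eB[OF that]] A(1) by (simp add: bij_betw_def)
    then show "s ! j < m" "eA (s ! j) = r (eB j)"
      using inv_into_into[of "r (eB j)" eA "{..<m}"] f_inv_into_f[of "r (eB j)" eA "{..<m}"] that
      by (simp_all add: s_def)
  qed
  have len: "length s = n" by (simp add: s_def)
  have "rigid 0 m s"
  proof (rule rigidI)
    show "set s \<subseteq> {..<0 + m}" using s(1) len by (auto simp: in_set_conv_nth)
    fix i assume "i < m"
    then have "eA i \<in> QA" using A(1) by (auto simp: bij_betw_def)
    then obtain U where U: "U \<in> QB" "r U = eA i" "\<And>U'. U' \<in> QB \<Longrightarrow> ltB U' U \<Longrightarrow> ltA (r U') (eA i)"
      using first by blast
    then obtain j where j: "j < n" "eB j = U" using B(1) by (auto simp: bij_betw_def)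
    have sj: "s ! j = i"
      using s[OF j(1)] j(2) U(2) \<open>i < m\<close> A(1) by (auto simp: bij_betw_def inj_on_def)
    have "s = take j s @ s ! j # drop (Suc j) s"
      using j(1) len by (intro id_take_nth_drop) simp
    then have "s = take j s @ (0 + i) # drop (Suc j) s" by (simp only: sj add_0)
    moreover have "s ! j' < i" if "j' < j" for j'
    proof -
      have "ltB (eB j') U" using B(2)[of j' j] j that by auto
      then have "ltA (eA (s ! j')) (eA i)" using U(3) eB[of j'] s(2)[of j'] that j(1) by auto
      then show ?thesis using A(2) s(1)[of j'] that j(1) \<open>i < m\<close> by auto
    qed
    then have "set (take j s) \<subseteq> {..<0 + i}" by (auto simp: in_set_conv_nth)
    ultimately show "\<exists>u v. s = u @ (0 + i) # v \<and> set u \<subseteq> {..<0 + i}" by blast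
  qed
  then show thesis using len s(2) by (intro that[of s]) (auto simp: words_def)
qed

section \<open>Substructures and order preserving maps\<close>

lemma PL_D:
  assumes "S \<in> PL k"
  shows "finite (ground S)" "order S \<subseteq> ground S \<times> ground S" "irrefl (order S)" "trans (order S)"
    "length (linear_orders S) = k"
  using assms by (auto simp: PL_def strict_partial_order_on_def)

lemma PL_linear_D:
  assumes "S \<in> PL k" "i < k"
  shows "linear_orders S ! i \<subseteq> ground S \<times> ground S" "trans (linear_orders S ! i)"
    "irrefl (linear_orders S ! i)" "total_on (ground S) (linear_orders S ! i)"
    "order S \<subseteq> linear_orders S ! i"
  using assms by (auto simp: PL_def strict_linear_order_on_def)

lemma order_preserving_comp:
  "order_preserving k S T f \<Longrightarrow> order_preserving k T U g \<Longrightarrow> order_preserving k S U (g \<circ> f)"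
  unfolding order_preserving_def by (auto simp: image_subset_iff)

lemma order_preserving_inv:
  assumes "order_preserving k S T f" "bij_betw f (ground S) (ground T)"
  shows "order_preserving k T S (inv_into (ground S) f)"
proof -
  have "inv_into (ground S) f y \<in> ground S" "f (inv_into (ground S) f y) = y" if "y \<in> ground T" for y
    using that assms(2) by (auto simp: bij_betw_def intro: inv_into_into f_inv_into_f)
  with assms(1) show ?thesis
    unfolding order_preserving_def by (auto simp: image_subset_iff)
qed

lemma order_preserving_inj:
  assumes "1 \<le> k" "S \<in> PL k" "T \<in> PL k" "order_preserving k S T f"
  shows "inj_on f (ground S)"
proof (rule inj_onI, rule ccontr)
  fix x y assume xy: "x \<in> ground S" "y \<in> ground S" "f x = f y" "x \<noteq> y"
  have "0 < k" using assms(1) by simp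
  then have "(x, y) \<in> linear_orders S ! 0 \<or> (y, x) \<in> linear_orders S ! 0"
    using PL_linear_D(4)[OF assms(2)] xy by (auto simp: total_on_def)
  then have "(f x, f x) \<in> linear_orders T ! 0"
    using assms(4) xy \<open>0 < k\<close> unfolding order_preserving_def by metis
  then show False using PL_linear_D(3)[OF assms(3) \<open>0 < k\<close>] by (auto simp: irrefl_def)
qed

definition induced :: "'a multi_ordered_set \<Rightarrow> 'a set \<Rightarrow> 'a multi_ordered_set" where
  "induced T Y = Triple Y (Restr (order T) Y) (map (\<lambda>L. Restr L Y) (linear_orders T))"

lemma induced_PL:
  assumes "T \<in> PL k" "Y \<subseteq> ground T"
  shows "induced T Y \<in> PL k"
proof -
  note D = PL_D[OF assms(1)] and L = PL_linear_D[OF assms(1)]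
  have "trans (Restr R Y)" if "trans R" for R :: "'a rel"
    using that unfolding trans_def by blast
  moreover have "strict_linear_order_on Y (Restr (linear_orders T ! i) Y)" if "i < k" for i
    using L(2-4)[OF that] assms(2) calculation
    by (auto simp: strict_linear_order_on_def irrefl_def total_on_def subset_eq)
  moreover have "(x, y) \<in> linear_orders T ! i" if "(x, y) \<in> order T" "i < k" for x y i
    using that L(5) by blast
  ultimately show ?thesis
    using D(1-4) assms(2)
    by (auto simp: PL_def induced_def strict_partial_order_on_def irrefl_def D(5)
        intro: finite_subset)
qed

lemma substructure_induced:
  "T \<in> PL k \<Longrightarrow> Y \<subseteq> ground T \<Longrightarrow> substructure k (induced T Y) T"
  by (auto simp: substructure_def induced_def PL_D(5))

lemma substructure_eq_induced:
  assumes "Z \<in> PL k" "T \<in> PL k" "substructure k Z T"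
  shows "Z = induced T (ground Z)"
proof (cases Z)
  case (Triple X P Ls)
  then show ?thesis
    using assms by (auto simp: substructure_def induced_def PL_def intro!: nth_equalityI)
qed

lemma substructure_trans:
  assumes ZY: "substructure k Z Y" and YT: "substructure k Y T"
  shows "substructure k Z T"
proof -
  have "ground Z \<subseteq> ground Y" using ZY by (simp add: substructure_def)
  then have "Restr R (ground Z) = Restr (Restr R (ground Y)) (ground Z)" for R by blast
  then show ?thesis
    using assms unfolding substructure_def by (metis subset_trans)
qed

lemma order_preserving_substructure:
  "substructure k Z T \<Longrightarrow> order_preserving k Z T id"
  unfolding substructure_def order_preserving_def by auto

definition relabel :: "('a \<Rightarrow> 'b) \<Rightarrow> 'a multi_ordered_set \<Rightarrow> 'b multi_ordered_set" where
  "relabel f S = Triple (f ` ground S) (map_prod f f ` order S)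
     (map ((`) (map_prod f f)) (linear_orders S))"

lemma mem_map_prod_image: "inj f \<Longrightarrow> (f x, f y) \<in> map_prod f f ` R \<longleftrightarrow> (x, y) \<in> R"
  by (auto dest: injD)

lemma relabel_order_preserving:
  "inj f \<Longrightarrow> S \<in> PL k \<Longrightarrow> order_preserving k S (relabel f S) f"
  by (auto simp: order_preserving_def relabel_def mem_map_prod_image PL_D(5))

lemma relabel_PL:
  assumes f: "inj f" and S: "S \<in> PL k"
  shows "relabel f S \<in> PL k"
proof -
  note D = PL_D[OF S] and L = PL_linear_D[OF S]
  have tr: "trans (map_prod f f ` R)" if "trans R" for R
    using that f by (auto intro!: transI dest: transD injD)
  have ir: "irrefl (map_prod f f ` R)" if "irrefl R" for R
    using that f by (auto simp: irrefl_def dest: injD)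
  have to: "total_on (f ` X) (map_prod f f ` R)" if "total_on X R" for X R
    using that unfolding total_on_def by (auto simp: mem_map_prod_image[OF f])
  have "map_prod f f ` R \<subseteq> f ` X \<times> f ` X" if "R \<subseteq> X \<times> X" for X R
    using that by auto
  then show ?thesis
    using D L tr ir to
    by (simp add: PL_def relabel_def strict_partial_order_on_def strict_linear_order_on_def image_mono)
qed

section \<open>The cube of labelled words\<close>

abbreviation "nat_lex \<equiv> lexord {(x :: nat, y). x < y}"

lemma lex_le_less:
  "list_all2 (\<le>) xs ys \<Longrightarrow> x < y \<Longrightarrow> (xs @ x # xs', ys @ y # ys') \<in> nat_lex"
  by (induction rule: list_all2_induct) auto

lemma lex_le: "list_all2 (\<le>) xs ys \<Longrightarrow> xs \<noteq> ys \<Longrightarrow> (xs, ys) \<in> nat_lex"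
  by (induction rule: list_all2_induct) auto

definition bits :: "(nat \<times> bool) list \<Rightarrow> nat list" where
  "bits v = map (\<lambda>l. of_bool (snd l)) v"

text \<open>
  The \<open>i\<close>-th linear order compares the bits at the letters with label \<open>i\<close> lexicographically. The labels
  come first so that only words with the same labels are compared in this way; the final part
  breaks ties and makes the key injective.
\<close>

definition key :: "nat \<Rightarrow> (nat \<times> bool) list \<Rightarrow> nat list" where
  "key i v = map fst v @ bits (filter (\<lambda>l. fst l = i) v) @ bits v"

lemma key_inj:
  assumes "length v = length w" "key i v = key i w"
  shows "v = w"
proof -
  have "map fst v = map fst w" "bits v = bits w"
    using assms by (auto simp: key_def bits_def)
  then show ?thesis
    using assms(1) by (auto simp: bits_def list_eq_iff_nth_eq prod_eq_iff of_bool_eq_iff)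
qed

definition letter_le :: "nat \<times> bool \<Rightarrow> nat \<times> bool \<Rightarrow> bool" where
  "letter_le l l' \<longleftrightarrow> fst l = fst l' \<and> snd l \<le> snd l'"

lemma key_mono:
  assumes "list_all2 letter_le v w"
  shows "list_all2 (\<le>) (key i v) (key i w)"
proof -
  have "list_all2 (\<le>) (map fst v) (map fst w)"
    "list_all2 (\<le>) (bits (filter (\<lambda>l. fst l = i) v)) (bits (filter (\<lambda>l. fst l = i) w))"
    "list_all2 (\<le>) (bits v) (bits w)"
    using assms by (induction rule: list_all2_induct) (auto simp: bits_def letter_le_def)
  then show ?thesis unfolding key_def by (intro list_all2_appendI)
qed

definition cube :: "nat \<Rightarrow> nat \<Rightarrow> (nat \<times> bool) list multi_ordered_set" where
  "cube k N = (let W = {v. set v \<subseteq> {..<k} \<times> UNIV \<and> length v = N} in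
     Triple W {(v, w). v \<in> W \<and> w \<in> W \<and> v \<noteq> w \<and> list_all2 letter_le v w}
       (map (\<lambda>i. {(v, w). v \<in> W \<and> w \<in> W \<and> (key i v, key i w) \<in> nat_lex}) [0..<k]))"

lemma cube_simps:
  "ground (cube k N) = {v. set v \<subseteq> {..<k} \<times> UNIV \<and> length v = N}"
  "order (cube k N) = {(v, w). v \<in> ground (cube k N) \<and> w \<in> ground (cube k N) \<and>
     v \<noteq> w \<and> list_all2 letter_le v w}"
  "length (linear_orders (cube k N)) = k"
  "i < k \<Longrightarrow> linear_orders (cube k N) ! i = {(v, w). v \<in> ground (cube k N) \<and>
     w \<in> ground (cube k N) \<and> (key i v, key i w) \<in> nat_lex}"
  by (simp_all add: cube_def Let_def)

lemma cube_PL: "cube k N \<in> PL k"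
proof -
  have fin: "finite (ground (cube k N))"
    unfolding cube_simps by (rule finite_lists_length_eq) simp
  have antisym: "v = w" if "list_all2 letter_le v w" "list_all2 letter_le w v" for v w
    using list_all2_antisym[OF _ that] by (auto simp: letter_le_def prod_eq_iff)
  have trans_le: "list_all2 letter_le v x" if "list_all2 letter_le v w" "list_all2 letter_le w x" for v w x
    by (rule list_all2_trans[OF _ that]) (auto simp: letter_le_def)
  have "trans (order (cube k N))"
    unfolding cube_simps(2) by (rule transI) (use antisym trans_le in blast)
  then have P: "strict_partial_order_on (ground (cube k N)) (order (cube k N))"
    by (auto simp: strict_partial_order_on_def cube_simps(2) irrefl_def)
  have lin: "strict_linear_order_on (ground (cube k N)) (linear_orders (cube k N) ! i)" if "i < k" for i
  proof -
    let ?L = "linear_orders (cube k N) ! i"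
    have "trans ?L"
      unfolding cube_simps(4)[OF that]
      by (rule transI) (auto elim: lexord_trans simp: trans_def)
    moreover have "irrefl ?L"
      unfolding cube_simps(4)[OF that] by (auto simp: irrefl_def lexord_irreflexive)
    moreover have "(v, w) \<in> ?L \<or> (w, v) \<in> ?L"
      if vw: "v \<in> ground (cube k N)" "w \<in> ground (cube k N)" "v \<noteq> w" for v w
    proof -
      have "key i v \<noteq> key i w" using vw key_inj[of v w i] by (auto simp: cube_simps(1))
      moreover have "\<forall>x y. (x, y) \<in> {(x :: nat, y). x < y} \<or> x = y \<or> (y, x) \<in> {(x, y). x < y}"
        by auto
      ultimately have "(key i v, key i w) \<in> nat_lex \<or> (key i w, key i v) \<in> nat_lex"
        using lexord_linear by blast
      with vw show ?thesis unfolding cube_simps(4)[OF \<open>i < k\<close>] by blast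
    qed
    ultimately show ?thesis by (simp add: strict_linear_order_on_def total_on_def)
  qed
  have "order (cube k N) \<subseteq> linear_orders (cube k N) ! i" if "i < k" for i
  proof -
    have "(key i v, key i w) \<in> nat_lex"
      if "v \<in> ground (cube k N)" "w \<in> ground (cube k N)" "v \<noteq> w" "list_all2 letter_le v w" for v w
      using key_inj[of v w i] key_mono[OF that(4), of i] that(1-3)
      by (intro lex_le) (auto simp: cube_simps(1))
    then show ?thesis unfolding cube_simps(2) cube_simps(4)[OF that] by blast
  qed
  with fin P lin show ?thesis
    by (auto simp: PL_def cube_simps(3)) (auto simp: cube_simps(4))
qed

section \<open>Coding a structure by its up-closed sets\<close>

definition upsets :: "'a multi_ordered_set \<Rightarrow> 'a set set" where
  "upsets S = {U. U \<subseteq> ground S \<and> (\<forall>x y. x \<in> U \<and> (x, y) \<in> order S \<longrightarrow> y \<in> U)}"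

definition up :: "'a multi_ordered_set \<Rightarrow> 'a set \<Rightarrow> 'a set" where
  "up S V = {y. \<exists>x\<in>V. x = y \<or> (x, y) \<in> order S}"

lemma up_in_upsets: "S \<in> PL k \<Longrightarrow> V \<subseteq> ground S \<Longrightarrow> up S V \<in> upsets S"
  using PL_D(2,4)[of S k] unfolding upsets_def up_def by (auto dest: transD)

text \<open>
  The least element, in the sense of \<open>L\<close>, on which \<open>U\<close> and \<open>V\<close> differ belongs to \<open>V\<close>. This is a
  lexicographic order on sets which extends inclusion.
\<close>

definition diff_less :: "'a rel \<Rightarrow> 'a set \<Rightarrow> 'a set \<Rightarrow> bool" where
  "diff_less L U V \<longleftrightarrow> (\<exists>d\<in>V - U. \<forall>e\<in>U - V. (d, e) \<in> L)"

lemma diff_less_trans: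
  assumes "trans L" "irrefl L" "total_on X L" "U \<subseteq> X" "V \<subseteq> X" "W \<subseteq> X"
    and "diff_less L U V" "diff_less L V W"
  shows "diff_less L U W"
proof -
  obtain d1 where d1: "d1 \<in> V" "d1 \<notin> U" "\<And>e. e \<in> U \<Longrightarrow> e \<notin> V \<Longrightarrow> (d1, e) \<in> L"
    using assms(7) by (auto simp: diff_less_def)
  obtain d2 where d2: "d2 \<in> W" "d2 \<notin> V" "\<And>e. e \<in> V \<Longrightarrow> e \<notin> W \<Longrightarrow> (d2, e) \<in> L"
    using assms(8) by (auto simp: diff_less_def)
  have "d1 \<noteq> d2" using d1 d2 by auto
  then consider "(d1, d2) \<in> L" "(d2, d1) \<notin> L" | "(d2, d1) \<in> L" "(d1, d2) \<notin> L"
    using assms(1-3,5,6) d1(1) d2(1) unfolding total_on_def irrefl_def by (metis subsetD transD)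
  then show ?thesis
  proof cases
    case 1
    then show ?thesis
      unfolding diff_less_def using d1 d2 \<open>trans L\<close>
      by (intro bexI[of _ d1]) (auto dest: transD)
  next
    case 2
    then show ?thesis
      unfolding diff_less_def using d1 d2 \<open>trans L\<close>
      by (intro bexI[of _ d2]) (auto dest: transD)
  qed
qed

lemma diff_less_total:
  assumes "trans L" "irrefl L" "total_on X L" "L \<subseteq> X \<times> X" "finite X"
    and "U \<subseteq> X" "V \<subseteq> X" "U \<noteq> V"
  shows "diff_less L U V \<or> diff_less L V U"
proof -
  define D where "D = (U - V) \<union> (V - U)"
  have "finite L" using assms(4,5) finite_subset by blast
  moreover have "acyclic L"
    using assms(1,2) by (simp add: acyclic_irrefl)
  ultimately have "wf L" by (rule finite_acyclic_wf)
  moreover have "D \<noteq> {}" using assms(8) by (auto simp: D_def)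
  ultimately obtain d where d: "d \<in> D" "\<And>y. (y, d) \<in> L \<Longrightarrow> y \<notin> D"
    by (meson ex_in_conv wfE_min)
  have min: "(d, e) \<in> L" if "e \<in> D" "e \<noteq> d" for e
    using that d assms(3,6,7) unfolding total_on_def D_def by blast
  show ?thesis
  proof (cases "d \<in> V")
    case True
    then show ?thesis using d(1) min unfolding diff_less_def D_def by blast
  next
    case False
    then show ?thesis using d(1) min unfolding diff_less_def D_def by blast
  qed
qed

definition coords :: "nat \<Rightarrow> 'a multi_ordered_set \<Rightarrow> (nat \<times> 'a set) set" where
  "coords k S = {..<k} \<times> upsets S"

fun coord_less :: "'a multi_ordered_set \<Rightarrow> nat \<times> 'a set \<Rightarrow> nat \<times> 'a set \<Rightarrow> bool" where
  "coord_less S (i, U) (j, V) \<longleftrightarrow> i < j \<or> i = j \<and> diff_less (linear_orders S ! i) U V"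

definition enumerates :: "nat \<Rightarrow> 'a multi_ordered_set \<Rightarrow> nat \<Rightarrow> (nat \<Rightarrow> nat \<times> 'a set) \<Rightarrow> bool" where
  "enumerates k S n e \<longleftrightarrow> bij_betw e {..<n} (coords k S) \<and>
     (\<forall>i<n. \<forall>j<n. coord_less S (e i) (e j) \<longleftrightarrow> i < j)"

lemma enumeration_exists:
  assumes "S \<in> PL k"
  shows "\<exists>e n. enumerates k S n e"
proof -
  have sub: "U \<subseteq> ground S" if "U \<in> upsets S" for U using that by (simp add: upsets_def)
  have "finite (upsets S)"
    using PL_D(1)[OF assms] by (rule finite_subset[rotated, OF finite_Pow_iff[THEN iffD2]]) (use sub in blast)
  then have fin: "finite (coords k S)" by (simp add: coords_def)
  have irr: "\<not> coord_less S x x" if "x \<in> coords k S" for x by (cases x) (simp add: diff_less_def)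
  have tr: "coord_less S x z"
    if "x \<in> coords k S" "y \<in> coords k S" "z \<in> coords k S" "coord_less S x y" "coord_less S y z" for x y z
  proof -
    obtain i U j V l W where eq: "x = (i, U)" "y = (j, V)" "z = (l, W)"
      by (metis surj_pair)
    have "i < k" "U \<subseteq> ground S" "V \<subseteq> ground S" "W \<subseteq> ground S"
      using that(1-3) sub by (simp_all add: eq coords_def)
    then have "diff_less (linear_orders S ! i) U W"
      if "diff_less (linear_orders S ! i) U V" "diff_less (linear_orders S ! i) V W"
      using that by (intro diff_less_trans[OF PL_linear_D(2,3,4)[OF assms], of i U V W])
    then show ?thesis using that(4,5) by (auto simp: eq)
  qed
  have to: "coord_less S x y \<or> coord_less S y x"
    if "x \<in> coords k S" "y \<in> coords k S" "x \<noteq> y" for x y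
  proof -
    obtain i U j V where eq: "x = (i, U)" "y = (j, V)"
      by (metis surj_pair)
    have "i < k" "U \<subseteq> ground S" "V \<subseteq> ground S"
      using that(1,2) sub by (simp_all add: eq coords_def)
    then have "diff_less (linear_orders S ! i) U V \<or> diff_less (linear_orders S ! i) V U" if "U \<noteq> V"
      using that by (intro diff_less_total[OF PL_linear_D(2,3,4,1)[OF assms] PL_D(1)[OF assms]])
    then show ?thesis using that(3) unfolding eq coord_less.simps prod.inject by (metis linorder_neqE_nat)
  qed
  show ?thesis
    by (rule finite_linear_enumeration[OF fin, of "coord_less S"])
      (fact irr tr to | (unfold enumerates_def, blast))+
qed

fun mark :: "'a \<Rightarrow> nat \<times> 'a set \<Rightarrow> nat \<times> bool" where
  "mark a (i, U) = (i, a \<in> U)"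

lemma mark_simps: "fst (mark a c) = fst c" "snd (mark a c) \<longleftrightarrow> a \<in> snd c"
  by (cases c; simp)+

text \<open>
  The word \<open>u\<close> lists coordinate numbers, and \<open>e\<close> translates them into coordinates. The element \<open>a\<close> becomes
  the word of its bits at these coordinates.
\<close>

definition code :: "(nat \<Rightarrow> nat \<times> 'a set) \<Rightarrow> nat list \<Rightarrow> 'a \<Rightarrow> (nat \<times> bool) list" where
  "code e u a = map (\<lambda>j. mark a (e j)) u"

text \<open>
  The partial order is reflected because \<open>up S {a}\<close> is among the coordinates. For \<open>a L\<^sub>i b\<close>, let
  \<open>U = up S {b}\<close>. It contains \<open>b\<close> and not \<open>a\<close>, and no \<open>V\<close> before \<open>U\<close> contains \<open>a\<close>: otherwise the
  least difference \<open>d \<in> U - V\<close> would satisfy \<open>d L\<^sub>i a L\<^sub>i b\<close>, though \<open>d\<close> is above \<open>b\<close>. As \<open>u\<close> is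
  rigid, only coordinates before \<open>(i, U)\<close> precede its first occurrence; so, at
  the letters labelled \<open>i\<close>, the bits of \<open>a\<close> are \<open>0\<close> up to that place, where \<open>b\<close> has bit \<open>1\<close>.
\<close>

lemma code_order_preserving:
  assumes k: "1 \<le> k" and S: "S \<in> PL k" and e: "enumerates k S n e" and u: "u \<in> words 0 n N"
  shows "order_preserving k S (cube k N) (code e u)"
proof -
  have rigid: "rigid 0 n u" and len: "length u = N" using u by (auto simp: words_def)
  have letters: "set u \<subseteq> {..<n}" using rigid_letters[OF rigid] by simp
  have e_coords: "e j \<in> coords k S" if "j < n" for j
    using e that by (auto simp: enumerates_def bij_betw_def)
  have coord: "\<exists>j<n. e j = (i, U)" if "i < k" "U \<in> upsets S" for i U
    using e that by (auto simp: enumerates_def bij_betw_def coords_def image_iff set_eq_iff)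
      (metis lessThan_iff)
  have occurs: "\<exists>u1 j u2. u = u1 @ j # u2 \<and> set u1 \<subseteq> {..<j} \<and> j < n \<and> e j = (i, U)"
    if "i < k" "U \<in> upsets S" for i U
    using coord[OF that] rigid_first_occurrence[OF rigid] by fastforce
  have ground: "code e u a \<in> ground (cube k N)" for a
    using e_coords letters len
    by (auto simp: cube_simps(1) code_def mark_simps coords_def subset_eq mem_Times_iff)
  have lt: "(code e u a, code e u b) \<in> linear_orders (cube k N) ! i"
    if i: "i < k" and ab: "(a, b) \<in> linear_orders S ! i" for a b i
  proof -
    note L = PL_linear_D[OF S i]
    have abg: "a \<in> ground S" "b \<in> ground S" using ab L(1) by auto
    define U where "U = up S {b}"
    have asym: "(b, a) \<notin> linear_orders S ! i" "a \<noteq> b"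
      using ab L(2,3) unfolding irrefl_def by (metis transD, blast)
    have U: "U \<in> upsets S" "b \<in> U" "a \<notin> U"
      using up_in_upsets[OF S, of "{b}"] abg asym L(5) by (auto simp: U_def up_def)
    obtain u1 j u2 where u_eq: "u = u1 @ j # u2" "set u1 \<subseteq> {..<j}" "j < n" "e j = (i, U)"
      using occurs[OF i U(1)] by blast
    have early: "a \<notin> snd (e j')" if j': "j' \<in> set u1" "fst (e j') = i" for j'
    proof
      assume a: "a \<in> snd (e j')"
      obtain V where V: "e j' = (i, V)" using j'(2) by (cases "e j'") auto
      have "j' < j" using j'(1) u_eq(2) by auto
      then have "coord_less S (e j') (e j)"
        using e u_eq(3) unfolding enumerates_def by simp
      then obtain d where d: "d \<in> U - V" "\<And>x. x \<in> V - U \<Longrightarrow> (d, x) \<in> linear_orders S ! i"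
        using V u_eq(4) by (auto simp: diff_less_def)
      have "(d, a) \<in> linear_orders S ! i" using d(2) a V U(3) by auto
      moreover have "d = b \<or> (b, d) \<in> linear_orders S ! i"
        using d(1) L(5) by (auto simp: U_def up_def)
      ultimately show False using asym(1) L(2) by (metis transD)
    qed
    let ?F = "filter (\<lambda>l. fst (e l) = i)"
    let ?x = "\<lambda>a j. of_bool (a \<in> snd (e j)) :: nat"
    have key: "key i (code e u c) = (map (\<lambda>j. fst (e j)) u @ map (?x c) (?F u1)) @ ?x c j #
        map (?x c) (?F u2) @ bits (code e u c)" for c
      using u_eq(4) unfolding key_def code_def bits_def
      by (simp add: filter_map comp_def mark_simps u_eq(1))
    have "list_all2 (\<le>) (map (\<lambda>j. fst (e j)) u @ map (?x a) (?F u1))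
      (map (\<lambda>j. fst (e j)) u @ map (?x b) (?F u1))"
      using early by (intro list_all2_appendI) (auto simp: list_all2_conv_all_nth list_all2_map1 list_all2_map2
          intro!: list_all2I dest!: nth_mem)
    then have "(key i (code e u a), key i (code e u b)) \<in> nat_lex"
      unfolding key by (rule lex_le_less) (use U u_eq(4) in simp)
    then show ?thesis unfolding cube_simps(4)[OF i] using ground by blast
  qed
  have lt_iff: "(a, b) \<in> linear_orders S ! i \<longleftrightarrow>
      (code e u a, code e u b) \<in> linear_orders (cube k N) ! i"
    if i: "i < k" and ab: "a \<in> ground S" "b \<in> ground S" for a b i
  proof -
    note C = PL_linear_D[OF cube_PL i, of N]
    have "(a, b) \<in> linear_orders S ! i" if *: "(code e u a, code e u b) \<in> linear_orders (cube k N) ! i"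
    proof (rule ccontr)
      assume "(a, b) \<notin> linear_orders S ! i"
      then consider "a = b" | "(b, a) \<in> linear_orders S ! i"
        using PL_linear_D(4)[OF S i] ab by (auto simp: total_on_def)
      then show False
        using * C(2,3) lt[OF i] unfolding irrefl_def by cases (auto dest: transD)
    qed
    then show ?thesis using lt[OF i] by blast
  qed
  have P_iff: "(a, b) \<in> order S \<longleftrightarrow> (code e u a, code e u b) \<in> order (cube k N)"
    if ab: "a \<in> ground S" "b \<in> ground S" for a b
  proof
    assume P: "(a, b) \<in> order S"
    have "list_all2 letter_le (code e u a) (code e u b)"
      using e_coords letters P
      by (auto simp: code_def list_all2_conv_all_nth letter_le_def mark_simps coords_def upsets_def
          mem_Times_iff subset_eq)
    moreover have "code e u a \<noteq> code e u b"
    proof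
      assume "code e u a = code e u b"
      moreover have "(code e u a, code e u b) \<in> linear_orders (cube k N) ! 0"
        using lt[of 0 a b] k P PL_linear_D(5)[OF S, of 0] by auto
      ultimately show False using PL_linear_D(3)[OF cube_PL, of 0 k N] k by (auto simp: irrefl_def)
    qed
    ultimately show "(code e u a, code e u b) \<in> order (cube k N)"
      using ground by (simp add: cube_simps(2))
  next
    assume "(code e u a, code e u b) \<in> order (cube k N)"
    then have ne: "a \<noteq> b" and le: "list_all2 letter_le (code e u a) (code e u b)"
      by (auto simp: cube_simps(2))
    have "up S {a} \<in> upsets S" using up_in_upsets[OF S] ab by simp
    then obtain u1 j u2 where "u = u1 @ j # u2" "e j = (0, up S {a})"
      using occurs[of 0] k by fastforce
    then have "letter_le (mark a (0, up S {a})) (mark b (0, up S {a}))"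
      using le by (auto simp: code_def list_all2_append1)
    then show "(a, b) \<in> order S" using ne by (auto simp: letter_le_def up_def)
  qed
  show ?thesis
    unfolding order_preserving_def using lt_iff P_iff ground by blast
qed

text \<open>
  Along an embedding \<open>f\<close> of \<open>A\<close> into \<open>B\<close>, up-closed sets of \<open>B\<close> are traced on \<open>A\<close>. The first
  coordinate with trace \<open>V\<close> is the up-closed set generated by \<open>f ` V\<close>, and all coordinates before it
  have traces before \<open>V\<close>. Hence the trace is given by a rigid word \<open>s\<close>, and \<open>subst 0 s\<close> sends the
  subspace which codes \<open>B\<close> to one which codes \<open>A\<close> along \<open>f\<close>.
\<close>

lemma restriction_word:
  assumes k: "1 \<le> k" and A: "A \<in> PL k" and B: "B \<in> PL k"
    and eA: "enumerates k A m eA" and eB: "enumerates k B n eB"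
    and f: "order_preserving k A B f"
  obtains s where "s \<in> words 0 m n"
    "\<And>u a. u \<in> words 0 n N \<Longrightarrow> a \<in> ground A \<Longrightarrow> code eA (subst 0 s u) a = code eB u (f a)"
proof -
  define tr where "tr U = {a \<in> ground A. f a \<in> U}" for U
  define r where "r c = (fst c, tr (snd c))" for c :: "nat \<times> 'b set"
  have fg: "f a \<in> ground B" if "a \<in> ground A" for a
    using f that by (auto simp: order_preserving_def)
  have fP: "(f a, f b) \<in> order B \<longleftrightarrow> (a, b) \<in> order A" if "a \<in> ground A" "b \<in> ground A" for a b
    using f that by (auto simp: order_preserving_def)
  have fL: "(f a, f b) \<in> linear_orders B ! i \<longleftrightarrow> (a, b) \<in> linear_orders A ! i"
    if "i < k" "a \<in> ground A" "b \<in> ground A" for i a b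
    using f that by (auto simp: order_preserving_def)
  note inj = order_preserving_inj[OF k A B f]
  have tr_upset: "tr U \<in> upsets A" if "U \<in> upsets B" for U
    using that fP PL_D(2)[OF A] by (fastforce simp: tr_def upsets_def)
  have tr_up: "tr (up B (f ` V)) = V" if V: "V \<in> upsets A" for V
    using V fP inj PL_D(2)[OF A] unfolding tr_def up_def upsets_def inj_on_def by blast
  have tr_less: "diff_less (linear_orders A ! i) (tr U) V"
    if i: "i < k" and V: "V \<in> upsets A" and U: "U \<in> upsets B"
      and less: "diff_less (linear_orders B ! i) U (up B (f ` V))" for i U V
  proof -
    note L = PL_linear_D[OF B i]
    have VA: "V \<subseteq> ground A" using V by (simp add: upsets_def)
    obtain d where d: "d \<in> up B (f ` V)" "d \<notin> U"
      "\<And>x. x \<in> U \<Longrightarrow> x \<notin> up B (f ` V) \<Longrightarrow> (d, x) \<in> linear_orders B ! i"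
      using less by (auto simp: diff_less_def)
    then obtain v where v: "v \<in> V" "f v = d \<or> (f v, d) \<in> order B" by (auto simp: up_def)
    have "f v \<notin> U" using U v(2) d(2) by (auto simp: upsets_def)
    moreover have "(v, x) \<in> linear_orders A ! i" if x: "x \<in> tr U" "x \<notin> V" for x
    proof -
      have "x \<notin> tr (up B (f ` V))" using tr_up[OF V] x by simp
      then have "(d, f x) \<in> linear_orders B ! i" using x d(3) by (auto simp: tr_def)
      then have "(f v, f x) \<in> linear_orders B ! i" using v(2) L(2,5) by (metis subsetD transD)
      then show ?thesis using fL[OF i, of v x] v(1) VA x by (auto simp: tr_def)
    qed
    ultimately show ?thesis using v(1) unfolding diff_less_def tr_def by blast
  qed
  have r_coords: "r c \<in> coords k A" if "c \<in> coords k B" for c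
    using that tr_upset by (auto simp: r_def coords_def)
  have first: "\<exists>U\<in>coords k B. r U = V \<and> (\<forall>U'\<in>coords k B. coord_less B U' U \<longrightarrow> coord_less A (r U') V)"
    if "V \<in> coords k A" for V
  proof -
    obtain i V0 where V: "V = (i, V0)" "i < k" "V0 \<in> upsets A" using \<open>V \<in> coords k A\<close> by (auto simp: coords_def)
    have "V0 \<subseteq> ground A" using V(3) by (simp add: upsets_def)
    then have "f ` V0 \<subseteq> ground B" using fg by auto
    then have "up B (f ` V0) \<in> upsets B" by (rule up_in_upsets[OF B])
    then show ?thesis
      using V tr_less[OF V(2,3)] tr_up[OF V(3)]
      by (intro bexI[of _ "(i, up B (f ` V0))"]) (auto simp: coords_def r_def)
  qed
  obtain s where s: "s \<in> words 0 m n" "\<And>j. j < n \<Longrightarrow> eA (s ! j) = r (eB j)"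
    using rigid_word_of_projection[of eA m "coords k A" "coord_less A" eB n "coords k B" "coord_less B" r]
      eA eB r_coords first unfolding enumerates_def by blast
  have "code eA (subst 0 s u) a = code eB u (f a)" if u: "u \<in> words 0 n N" and a: "a \<in> ground A" for u a
  proof -
    have "set u \<subseteq> {..<n}" using u rigid_letters[of 0 n u] by (simp add: words_def)
    moreover have "mark a (r c) = mark (f a) c" for c
      using a by (cases c) (simp add: r_def tr_def)
    ultimately have "mark a (eA (s ! j)) = mark (f a) (eB j)" if "j \<in> set u" for j
      using s(2)[of j] that by (metis lessThan_iff subsetD)
    then show ?thesis by (simp add: code_def subst_def)
  qed
  with s(1) show thesis by (rule that)
qed

section \<open>The Ramsey property\<close>

theorem theorem8:
  fixes k :: nat and A :: "'a multi_ordered_set" and B :: "'b multi_ordered_set"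
  assumes "k \<ge> 1" and "A \<in> PL k" and "B \<in> PL k"
  shows "\<exists>C :: nat multi_ordered_set. C \<in> PL k \<and>
    (\<forall>\<chi> :: nat multi_ordered_set \<Rightarrow> bool.
      \<exists>B' \<in> copies k C B. monochromatic \<chi> (copies k B' A))"
proof -
  obtain eA m where eA: "enumerates k A m eA" using enumeration_exists[OF assms(2)] by blast
  obtain eB n where eB: "enumerates k B n eB" using enumeration_exists[OF assms(3)] by blast
  obtain N where N: "\<forall>c :: nat list \<Rightarrow> bool. \<exists>u\<in>words 0 n N.
      \<forall>s\<in>words 0 m n. \<forall>t\<in>words 0 m n. c (subst 0 s u) = c (subst 0 t u)"
    using GR_at[OF Graham_Rothschild, of 0 n] by (rule exE)
  define C :: "nat multi_ordered_set" where "C = relabel to_nat (cube k N)"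
  have C: "C \<in> PL k" unfolding C_def by (intro relabel_PL cube_PL inj_to_nat)
  have "\<exists>B' \<in> copies k C B. monochromatic \<chi> (copies k B' A)" for \<chi> :: "nat multi_ordered_set \<Rightarrow> bool"
  proof -
    \<comment> \<open>a rigid word \<open>t\<close> gets the colour of the copy of \<open>A\<close> that it codes\<close>
    define c where "c t = \<chi> (induced C ((to_nat \<circ> code eA t) ` ground A))" for t
    obtain u where u: "u \<in> words 0 n N"
      and ucol: "\<forall>s\<in>words 0 m n. \<forall>t\<in>words 0 m n. c (subst 0 s u) = c (subst 0 t u)"
      using N by blast
    define \<beta> where "\<beta> = to_nat \<circ> code eB u"
    have \<beta>: "order_preserving k B C \<beta>"
      unfolding \<beta>_def C_def
      by (rule order_preserving_comp[OF code_order_preserving[OF assms(1,3) eB u]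
            relabel_order_preserving[OF inj_to_nat cube_PL]])
    define B' where "B' = induced C (\<beta> ` ground B)"
    have sub: "\<beta> ` ground B \<subseteq> ground C" using \<beta> by (simp add: order_preserving_def)
    have B': "B' \<in> PL k" "substructure k B' C" "ground B' = \<beta> ` ground B"
      unfolding B'_def using C sub by (auto intro: induced_PL substructure_induced) (auto simp: induced_def)
    have bij: "bij_betw \<beta> (ground B) (ground B')"
      using order_preserving_inj[OF assms(1,3) C \<beta>] B'(3) by (simp add: bij_betw_def)
    have "order_preserving k B B' \<beta>"
      using \<beta> PL_D(5)[OF C] by (auto simp: order_preserving_def B'_def induced_def)
    then have \<beta>_inv: "order_preserving k B' B (inv_into (ground B) \<beta>)"
      using bij by (rule order_preserving_inv)
    have "isomorphic k B' B"
      unfolding isomorphic_def using \<beta>_inv bij_betw_inv_into[OF bij] by blast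
    with B' have B'_copy: "B' \<in> copies k C B" by (simp add: copies_def)
    have "\<exists>s\<in>words 0 m n. \<chi> Z = c (subst 0 s u)" if Z: "Z \<in> copies k B' A" for Z
    proof -
      have ZPL: "Z \<in> PL k" and ZB: "substructure k Z B'" and "isomorphic k Z A"
        using Z by (auto simp: copies_def)
      then obtain \<pi> where \<pi>: "order_preserving k Z A \<pi>" "bij_betw \<pi> (ground Z) (ground A)"
        by (auto simp: isomorphic_def)
      define g where "g = inv_into (ground Z) \<pi>"
      have g: "order_preserving k A Z g" "g ` ground A = ground Z"
        unfolding g_def using order_preserving_inv[OF \<pi>] bij_betw_inv_into[OF \<pi>(2)]
        by (auto simp: bij_betw_def)
      define f where "f = inv_into (ground B) \<beta> \<circ> g"
      have f: "order_preserving k A B f"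
        unfolding f_def
        using order_preserving_comp[OF order_preserving_comp[OF g(1) order_preserving_substructure[OF ZB]] \<beta>_inv]
        by simp
      have \<beta>f: "\<beta> (f a) = g a" if "a \<in> ground A" for a
      proof -
        have "g a \<in> \<beta> ` ground B"
          using that g(2) ZB B'(3) by (auto simp: substructure_def)
        then show ?thesis by (simp add: f_def f_inv_into_f)
      qed
      obtain s where s: "s \<in> words 0 m n" "\<And>u a. u \<in> words 0 n N \<Longrightarrow> a \<in> ground A \<Longrightarrow>
          code eA (subst 0 s u) a = code eB u (f a)"
        using restriction_word[OF assms eA eB f, of N] by blast
      have "(to_nat \<circ> code eA (subst 0 s u)) ` ground A = g ` ground A"
        using s(2)[OF u] \<beta>f by (intro image_cong) (auto simp: \<beta>_def)
      then have "\<chi> Z = c (subst 0 s u)"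
        unfolding c_def g(2)
        using substructure_eq_induced[OF ZPL C substructure_trans[OF ZB B'(2)]] by simp
      with s(1) show ?thesis by blast
    qed
    then have "monochromatic \<chi> (copies k B' A)"
      unfolding monochromatic_def using ucol by metis
    with B'_copy show ?thesis by blast
  qed
  with C show ?thesis by blast
qed

end
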